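(* For all $a^{(k)}\in\Lambda^k(\Omega)$, $$\pi_h^\star\,\mathrm d^*a^{(k)}=\mathrm d^*\,\pi_h^\star\,a^{(k)}\qquad\text{and}\qquad \tilde\pi_h^\star\,\mathrm d^*a^{(k)}=\mathrm d^*\,\tilde\pi_h^\star\,a^{(k)},$$ i.e. the canonical coprojections $\pi_h^\star$ and $\tilde\pi_h^\star$ commute with the codifferential $\mathrm d^*$.
   Context: $\Omega$ is an $n$-dimensional oriented Riemannian manifold and $\Lambda^k(\Omega)$ its space of differential $k$-forms. $\star$ is the Hodge star, $a^{(k)}\wedge\star b^{(k)}=(a^{(k)},b^{(k)})\,w^{(n)}$ with $w^{(n)}$ the volume form, so $\star\star=(-1)^{k(n-k)}$ on $k$-forms. The codifferential $\mathrm d^*:\Lambda^k(\Omega)\to\Lambda^{k-1}(\Omega)$ is $\mathrm d^*=(-1)^{n(k+1)+1}\star\mathrm d\,\star$. $D$ is a finite oriented cell complex covering $\Omega$, $\tilde D$ its dual cell complex (each $k$-cell of $D$ corresponds to a dual $(n-k)$-cell). Projections are built on the interior parts $D_i$ and $\tilde D_i$ ($\tilde D_i$ being the dual cells of the cells of $D_i$). $C^k$ denotes $k$-cochains (real linear functionals on $k$-chains) and $\delta:C^k\to C^{k+1}$ the coboundary, adjoint of the boundary operator. $\mathcal R:\Lambda^k(\Omega)\to C^k$ is the reduction $\langle\mathcal Ra,c\rangle=\int_ca$, satisfying $\mathcal R\,\mathrm d=\delta\,\mathcal R$. $\mathcal I:C^k\to\Lambda^k(\Omega)$ is a linear reconstruction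 satisfying $\mathcal R\mathcal I=\mathrm{Id}$ and $\mathrm d\,\mathcal I=\mathcal I\,\delta$. The operators $\tilde{\mathcal R},\tilde{\mathcal I}$ are the corresponding maps for the dual complex, satisfying the same relations. $\pi_h:=\mathcal I\circ\mathcal R$ and $\tilde\pi_h:=\tilde{\mathcal I}\circ\tilde{\mathcal R}$. The canonical coprojections on $k$-forms are $\pi_h^\star:=(-1)^{k(n-k)}\star\tilde\pi_h\star$ and $\tilde\pi_h^\star:=(-1)^{k(n-k)}\star\pi_h\star$. *)

theory Defs
  imports "HOL-Analysis.Analysis"
begin

section \<open>Smooth functions\<close>

text \<open>
  Derivatives are taken within \<open>S\<close>, because charts of manifolds with boundary have relatively
  open subsets of half-spaces as images. On such sets derivatives within \<open>S\<close> are unique; on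
  open sets they are the usual ones.
\<close>

primrec Ck_on :: "nat \<Rightarrow> 'a::real_normed_vector set \<Rightarrow> ('a \<Rightarrow> 'b::real_normed_vector) \<Rightarrow> bool" where
  "Ck_on 0 S f \<longleftrightarrow> continuous_on S f"
| "Ck_on (Suc m) S f \<longleftrightarrow> f differentiable_on S \<and>
     (\<forall>v. Ck_on m S (\<lambda>x. frechet_derivative f (at x within S) v))"

definition smooth_on :: "'a::real_normed_vector set \<Rightarrow> ('a \<Rightarrow> 'b::real_normed_vector) \<Rightarrow> bool" where
  "smooth_on S f \<longleftrightarrow> (\<forall>m. Ck_on m S f)"


section \<open>Alternating multilinear forms on a single vector space\<close>

text \<open>
  A \<open>k\<close>-linear form takes its arguments as a sequence of vectors of which only the first \<open>k\<close>
  entries matter.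
\<close>

definition alternating :: "nat \<Rightarrow> ((nat \<Rightarrow> 'v::real_vector) \<Rightarrow> real) \<Rightarrow> bool" where
  "alternating k f \<longleftrightarrow>
     (\<forall>v v'. (\<forall>i<k. v i = v' i) \<longrightarrow> f v = f v') \<and>
     (\<forall>v. \<forall>i<k. linear (\<lambda>x. f (v(i := x)))) \<and>
     (\<forall>v. \<forall>i<k. \<forall>j<k. i \<noteq> j \<and> v i = v j \<longrightarrow> f v = 0)"

definition wedge :: "nat \<Rightarrow> nat \<Rightarrow> ((nat \<Rightarrow> 'v) \<Rightarrow> real) \<Rightarrow> ((nat \<Rightarrow> 'v) \<Rightarrow> real) \<Rightarrow> (nat \<Rightarrow> 'v) \<Rightarrow> real" where
  "wedge k l a b v =
     (\<Sum>p | p permutes {..<k + l}.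
        of_int (sign p) * a (\<lambda>i. v (p i)) * b (\<lambda>i. v (p (k + i)))) / (fact k * fact l)"

text \<open>
  The inner product on \<open>k\<close>-forms induced by the inner product with Gram matrix \<open>G\<close>: both sets
  of components are contracted with the inverse metric. The factor \<open>1 / k!\<close> makes the wedge
  products of distinct elements of an orthonormal coframe unit vectors.
\<close>

definition form_inner :: "nat \<Rightarrow> real^'n^'n \<Rightarrow> ((nat \<Rightarrow> real^'n) \<Rightarrow> real) \<Rightarrow> ((nat \<Rightarrow> real^'n) \<Rightarrow> real) \<Rightarrow> real" where
  "form_inner k G a b =
     (\<Sum>I \<in> {..<k} \<rightarrow>\<^sub>E UNIV. \<Sum>J \<in> {..<k} \<rightarrow>\<^sub>E UNIV.
        (\<Prod>m<k. matrix_inv G $ I m $ J m) *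
        a (\<lambda>m. axis (I m) 1) * b (\<lambda>m. axis (J m) 1)) / fact k"

text \<open>
  The order of the index type fixes the standard orientation of \<open>real^'n\<close>: the coordinate
  vectors, taken in increasing order, are positively oriented.
\<close>

definition index_rank :: "'n::{finite,linorder} \<Rightarrow> nat" where
  "index_rank i = card {j. j < i}"

definition volume ::
    "real^('n::{finite,linorder})^('n::{finite,linorder}) \<Rightarrow> (nat \<Rightarrow> real^('n::{finite,linorder})) \<Rightarrow> real" where
  "volume G v = sqrt (det G) * det (\<chi> i. v (index_rank i))"


section \<open>Oriented Riemannian manifolds\<close>

text \<open>
  A chart is a pair of its domain and its coordinate map. The dimension is \<open>CARD('n)\<close>.
  \<open>metric M c p\<close> is the Gram matrix of the metric at the point \<open>p\<close> in the chart \<open>c\<close>. The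
  boundary may be empty (for \<open>b = 0\<close> the half-space below is the whole space).
\<close>

type_synonym ('m, 'n) chart = "'m set \<times> ('m \<Rightarrow> real^'n)"

record ('m, 'n) riemannian =
  space_top :: "'m topology"
  atlas :: "('m, 'n) chart set"
  metric :: "('m, 'n) chart \<Rightarrow> 'm \<Rightarrow> real^'n^'n"

definition is_chart :: "'m topology \<Rightarrow> ('m, 'n::finite) chart \<Rightarrow> bool" where
  "is_chart T c \<longleftrightarrow>
     openin T (fst c) \<and>
     (\<exists>b. openin (top_of_set {x. 0 \<le> x \<bullet> b}) (snd c ` fst c)) \<and>
     homeomorphic_map (subtopology T (fst c)) (top_of_set (snd c ` fst c)) (snd c)"

abbreviation chart_inv :: "('m, 'n::finite) chart \<Rightarrow> real^'n \<Rightarrow> 'm" where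
  "chart_inv c \<equiv> inv_into (fst c) (snd c)"

definition transition_jacobian :: "('m, 'n::finite) chart \<Rightarrow> ('m, 'n) chart \<Rightarrow> 'm \<Rightarrow> real^'n^'n" where
  "transition_jacobian c c' p =
     jacobian (snd c' \<circ> chart_inv c) (at (snd c p) within snd c ` (fst c \<inter> fst c'))"

definition oriented_riemannian_manifold :: "('m, 'n::{finite,linorder}) riemannian \<Rightarrow> bool" where
  "oriented_riemannian_manifold M \<longleftrightarrow>
     Hausdorff_space (space_top M) \<and> second_countable (space_top M) \<and>
     (\<forall>c \<in> atlas M. is_chart (space_top M) c) \<and>
     (\<Union>c \<in> atlas M. fst c) = topspace (space_top M) \<and>
     (\<forall>c \<in> atlas M. \<forall>c' \<in> atlas M.
        smooth_on (snd c ` (fst c \<inter> fst c')) (snd c' \<circ> chart_inv c)) \<and>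
     (\<forall>c \<in> atlas M. \<forall>c' \<in> atlas M. \<forall>p \<in> fst c \<inter> fst c'. det (transition_jacobian c c' p) > 0) \<and>
     (\<forall>c \<in> atlas M. smooth_on (snd c ` fst c) (\<lambda>x. metric M c (chart_inv c x))) \<and>
     (\<forall>c \<in> atlas M. \<forall>p \<in> fst c.
        transpose (metric M c p) = metric M c p \<and>
        (\<forall>v. v \<noteq> 0 \<longrightarrow> v \<bullet> (metric M c p *v v) > 0)) \<and>
     (\<forall>c \<in> atlas M. \<forall>c' \<in> atlas M. \<forall>p \<in> fst c \<inter> fst c'.
        metric M c p =
          transpose (transition_jacobian c c' p) ** metric M c' p ** transition_jacobian c c' p)"

definition manifold_boundary :: "('m, 'n::finite) riemannian \<Rightarrow> 'm set" where
  "manifold_boundary M = {p. \<exists>c \<in> atlas M. p \<in> fst c \<and> snd c p \<notin> interior (snd c ` fst c)}"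


section \<open>Differential forms\<close>

text \<open>
  A form is given by its local representations: \<open>\<omega> c p v\<close> is its value at the point \<open>p\<close> on
  tangent vectors with components \<open>v 0, v 1, \<dots>\<close> in the chart \<open>c\<close>. Smooth local representations
  have to be related by pullback along the transition maps. Representations vanish outside the
  domains of the charts, so that equality of forms is equality of functions.
\<close>

type_synonym ('m, 'n) form = "('m, 'n) chart \<Rightarrow> 'm \<Rightarrow> (nat \<Rightarrow> real^'n) \<Rightarrow> real"

definition forms :: "('m, 'n::finite) riemannian \<Rightarrow> nat \<Rightarrow> ('m, 'n) form set" where
  "forms M k = {\<omega>.
     (\<forall>c p v. \<not> (c \<in> atlas M \<and> p \<in> fst c) \<longrightarrow> \<omega> c p v = 0) \<and>
     (\<forall>c \<in> atlas M. \<forall>p \<in> fst c. alternating k (\<omega> c p)) \<and>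
     (\<forall>c \<in> atlas M. \<forall>v. smooth_on (snd c ` fst c) (\<lambda>x. \<omega> c (chart_inv c x) v)) \<and>
     (\<forall>c \<in> atlas M. \<forall>c' \<in> atlas M. \<forall>p \<in> fst c \<inter> fst c'. \<forall>v.
        \<omega> c p v = \<omega> c' p (\<lambda>i. transition_jacobian c c' p *v v i))}"

definition form_scale :: "real \<Rightarrow> ('m, 'n) form \<Rightarrow> ('m, 'n) form" where
  "form_scale r \<omega> = (\<lambda>c p v. r * \<omega> c p v)"

definition form_add :: "('m, 'n) form \<Rightarrow> ('m, 'n) form \<Rightarrow> ('m, 'n) form" where
  "form_add \<omega> \<eta> = (\<lambda>c p v. \<omega> c p v + \<eta> c p v)"

definition ext_deriv :: "('m, 'n::finite) riemannian \<Rightarrow> nat \<Rightarrow> ('m, 'n) form \<Rightarrow> ('m, 'n) form" where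
  "ext_deriv M k \<omega> = (\<lambda>c p v.
     if c \<in> atlas M \<and> p \<in> fst c then
       (\<Sum>i\<le>k. (- 1) ^ i *
          frechet_derivative
            (\<lambda>x. \<omega> c (chart_inv c x) (\<lambda>j. if j < i then v j else v (Suc j)))
            (at (snd c p) within snd c ` fst c) (v i))
     else 0)"

text \<open>
  The Hodge star on \<open>k\<close>-forms is determined pointwise by \<open>a \<and> \<star>b = (a, b) w\<close>. In degrees above
  the dimension the only form is zero, and so is its Hodge star.
\<close>

definition hodge_star ::
    "('m, 'n::{finite,linorder}) riemannian \<Rightarrow> nat \<Rightarrow> ('m, 'n) form \<Rightarrow> ('m, 'n) form" where
  "hodge_star M k b = (\<lambda>c p.
     if c \<in> atlas M \<and> p \<in> fst c \<and> k \<le> CARD('n) then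
       (THE f. alternating (CARD('n) - k) f \<and>
          (\<forall>a. alternating k a \<longrightarrow>
             wedge k (CARD('n) - k) a f =
               (\<lambda>v. form_inner k (metric M c p) a (b c p) * volume (metric M c p) v)))
     else (\<lambda>v. 0))"

text \<open>
  The codifferential of a 0-form is zero, because the Hodge star vanishes in degree \<open>CARD('n) + 1\<close>.
\<close>

definition codifferential ::
    "('m, 'n::{finite,linorder}) riemannian \<Rightarrow> nat \<Rightarrow> ('m, 'n) form \<Rightarrow> ('m, 'n) form" where
  "codifferential M k a =
     form_scale ((- 1) ^ (CARD('n) * (k + 1) + 1))
       (hodge_star M (CARD('n) - k + 1) (ext_deriv M (CARD('n) - k) (hodge_star M k a)))"


section \<open>Oriented cell complexes\<close>

definition cube :: "nat \<Rightarrow> (nat \<Rightarrow> real) set" where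
  "cube k = {..<k} \<rightarrow>\<^sub>E {0..1}"

definition cube_interior :: "nat \<Rightarrow> (nat \<Rightarrow> real) set" where
  "cube_interior k = {..<k} \<rightarrow>\<^sub>E {0<..<1}"

definition partial_deriv :: "((nat \<Rightarrow> real) \<Rightarrow> 'a::real_normed_vector) \<Rightarrow> nat \<Rightarrow> (nat \<Rightarrow> real) \<Rightarrow> 'a" where
  "partial_deriv f i t = vector_derivative (\<lambda>s. f (t(i := s))) (at (t i) within {0..1})"

text \<open>
  An oriented \<open>k\<close>-cell is a homeomorphic image of the closed \<open>k\<close>-cube under a continuously
  differentiable map; the map carries the orientation. It need not be an immersion, so cells
  such as simplices, polytopes or bent dual cells can be parametrised as well.
\<close>

definition is_cell :: "('m, 'n::finite) riemannian \<Rightarrow> nat \<Rightarrow> ((nat \<Rightarrow> real) \<Rightarrow> 'm) \<Rightarrow> bool" where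
  "is_cell M k \<sigma> \<longleftrightarrow>
     continuous_map (top_of_set (cube k)) (space_top M) \<sigma> \<and> inj_on \<sigma> (cube k) \<and>
     (\<forall>c \<in> atlas M. \<forall>i<k.
        (\<forall>t \<in> {t \<in> cube k. \<sigma> t \<in> fst c}.
           (\<lambda>s. snd c (\<sigma> (t(i := s)))) differentiable (at (t i) within {0..1})) \<and>
        continuous_on {t \<in> cube k. \<sigma> t \<in> fst c} (partial_deriv (\<lambda>t. snd c (\<sigma> t)) i))"

text \<open>
  \<open>incidence D \<sigma> \<tau>\<close> is the coefficient of \<open>\<tau>\<close> in the boundary of \<open>\<sigma>\<close>.
\<close>

record ('c, 'm) cell_complex =
  cells :: "'c set"
  cell_dim :: "'c \<Rightarrow> nat"
  param :: "'c \<Rightarrow> (nat \<Rightarrow> real) \<Rightarrow> 'm"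
  incidence :: "'c \<Rightarrow> 'c \<Rightarrow> int"

definition closed_cell :: "('c, 'm) cell_complex \<Rightarrow> 'c \<Rightarrow> 'm set" where
  "closed_cell D \<sigma> = param D \<sigma> ` cube (cell_dim D \<sigma>)"

definition open_cell :: "('c, 'm) cell_complex \<Rightarrow> 'c \<Rightarrow> 'm set" where
  "open_cell D \<sigma> = param D \<sigma> ` cube_interior (cell_dim D \<sigma>)"

definition cell_frontier :: "('c, 'm) cell_complex \<Rightarrow> 'c \<Rightarrow> 'm set" where
  "cell_frontier D \<sigma> = param D \<sigma> ` (cube (cell_dim D \<sigma>) - cube_interior (cell_dim D \<sigma>))"

text \<open>
  Finite oriented regular cell complexes covering the manifold. The frontier of a cell is the
  union of its faces, and distinct cells have disjoint relative interiors. The incidence numbers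
  satisfy \<open>\<partial>\<partial> = 0\<close> and, for an edge, are \<open>1\<close> at its end point and \<open>- 1\<close> at its starting
  point; this determines them up to one global sign for each cell of dimension at least 2. That
  these signs agree with the orientations given by the parametrisations is part of the relation
  between reduction and exterior derivative (Stokes' theorem).
\<close>

definition oriented_cell_complex :: "('m, 'n::finite) riemannian \<Rightarrow> ('c, 'm) cell_complex \<Rightarrow> bool" where
  "oriented_cell_complex M D \<longleftrightarrow>
     finite (cells D) \<and>
     (\<forall>\<sigma> \<in> cells D. cell_dim D \<sigma> \<le> CARD('n) \<and> is_cell M (cell_dim D \<sigma>) (param D \<sigma>)) \<and>
     (\<Union>\<sigma> \<in> cells D. closed_cell D \<sigma>) = topspace (space_top M) \<and>
     (\<forall>\<sigma> \<in> cells D. \<forall>\<tau> \<in> cells D. \<sigma> \<noteq> \<tau> \<longrightarrow> open_cell D \<sigma> \<inter> open_cell D \<tau> = {}) \<and>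
     (\<forall>\<sigma> \<in> cells D.
        cell_frontier D \<sigma> = (\<Union>\<tau> \<in> {\<tau> \<in> cells D. incidence D \<sigma> \<tau> \<noteq> 0}. closed_cell D \<tau>)) \<and>
     (\<forall>\<sigma> \<in> cells D. \<forall>\<tau> \<in> cells D. incidence D \<sigma> \<tau> \<in> {- 1, 0, 1} \<and>
        (incidence D \<sigma> \<tau> \<noteq> 0 \<longleftrightarrow>
           cell_dim D \<sigma> = Suc (cell_dim D \<tau>) \<and> closed_cell D \<tau> \<subseteq> cell_frontier D \<sigma>)) \<and>
     (\<forall>\<sigma> \<in> cells D. \<forall>\<rho> \<in> cells D.
        (\<Sum>\<tau> \<in> cells D. incidence D \<sigma> \<tau> * incidence D \<tau> \<rho>) = 0) \<and>
     (\<forall>\<sigma> \<in> cells D. \<forall>\<tau> \<in> cells D. cell_dim D \<sigma> = 1 \<and> cell_dim D \<tau> = 0 \<longrightarrow>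
        (param D \<sigma> (\<lambda>i\<in>{..<1}. 1) \<in> closed_cell D \<tau> \<longrightarrow> incidence D \<sigma> \<tau> = 1) \<and>
        (param D \<sigma> (\<lambda>i\<in>{..<1}. 0) \<in> closed_cell D \<tau> \<longrightarrow> incidence D \<sigma> \<tau> = - 1))"

text \<open>
  \<open>D'\<close> is dual to \<open>D\<close>: \<open>k\<close>-cells of \<open>D\<close> correspond to \<open>(n-k)\<close>-cells of \<open>D'\<close>, with faces and
  cofaces interchanged. If the manifold has a boundary, \<open>D'\<close> needs additional cells to close it
  up there.
\<close>

definition dual_complex ::
    "('m, 'n::finite) riemannian \<Rightarrow> ('c, 'm) cell_complex \<Rightarrow> ('d, 'm) cell_complex \<Rightarrow> ('c \<Rightarrow> 'd) \<Rightarrow> bool" where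
  "dual_complex M D D' dual \<longleftrightarrow>
     inj_on dual (cells D) \<and> dual ` cells D \<subseteq> cells D' \<and>
     (\<forall>\<sigma> \<in> cells D. cell_dim D' (dual \<sigma>) = CARD('n) - cell_dim D \<sigma>) \<and>
     (\<forall>\<sigma> \<in> cells D. \<forall>\<tau> \<in> cells D.
        \<bar>incidence D' (dual \<tau>) (dual \<sigma>)\<bar> = \<bar>incidence D \<sigma> \<tau>\<bar>) \<and>
     (\<forall>d \<in> cells D' - dual ` cells D. closed_cell D' d \<subseteq> manifold_boundary M)"


section \<open>Chains and cochains\<close>

text \<open>
  Everything below is relative to a set \<open>S\<close> of cells of a complex \<open>D\<close>, such as its interior
  part; faces outside \<open>S\<close> are dropped from boundaries. Chains are real linear combinations of
  cells in \<open>S\<close>, and cochains are linear functionals on chains (extended by zero, so that equality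
  of cochains is equality of functions).
\<close>

definition chains :: "('c, 'm) cell_complex \<Rightarrow> 'c set \<Rightarrow> nat \<Rightarrow> ('c \<Rightarrow> real) set" where
  "chains D S k = {x. \<forall>\<sigma>. x \<sigma> \<noteq> 0 \<longrightarrow> \<sigma> \<in> S \<and> cell_dim D \<sigma> = k}"

definition chain_boundary :: "('c, 'm) cell_complex \<Rightarrow> 'c set \<Rightarrow> ('c \<Rightarrow> real) \<Rightarrow> 'c \<Rightarrow> real" where
  "chain_boundary D S x = (\<lambda>\<tau>. if \<tau> \<in> S then \<Sum>\<sigma>\<in>S. x \<sigma> * of_int (incidence D \<sigma> \<tau>) else 0)"

definition cochains :: "('c, 'm) cell_complex \<Rightarrow> 'c set \<Rightarrow> nat \<Rightarrow> (('c \<Rightarrow> real) \<Rightarrow> real) set" where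
  "cochains D S k = {f.
     (\<forall>x. x \<notin> chains D S k \<longrightarrow> f x = 0) \<and>
     (\<forall>x \<in> chains D S k. \<forall>y \<in> chains D S k. f (\<lambda>\<sigma>. x \<sigma> + y \<sigma>) = f x + f y) \<and>
     (\<forall>x \<in> chains D S k. \<forall>r. f (\<lambda>\<sigma>. r * x \<sigma>) = r * f x)}"

definition coboundary ::
    "('c, 'm) cell_complex \<Rightarrow> 'c set \<Rightarrow> nat \<Rightarrow> (('c \<Rightarrow> real) \<Rightarrow> real) \<Rightarrow> ('c \<Rightarrow> real) \<Rightarrow> real" where
  "coboundary D S k f = (\<lambda>x. if x \<in> chains D S (Suc k) then f (chain_boundary D S x) else 0)"


section \<open>Reduction, reconstruction and coprojections\<close>

text \<open>
  The integral of a \<open>k\<close>-form over a \<open>k\<close>-cell is the integral of its pullback over the unit cube;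
  the integrand at \<open>t\<close> does not depend on the chart chosen around \<open>\<sigma> t\<close>.
\<close>

definition chart_at :: "('m, 'n::finite) riemannian \<Rightarrow> 'm \<Rightarrow> ('m, 'n) chart" where
  "chart_at M p = (SOME c. c \<in> atlas M \<and> p \<in> fst c)"

definition cell_integral ::
    "('m, 'n::finite) riemannian \<Rightarrow> nat \<Rightarrow> ((nat \<Rightarrow> real) \<Rightarrow> 'm) \<Rightarrow> ('m, 'n) form \<Rightarrow> real" where
  "cell_integral M k \<sigma> \<omega> =
     (LINT t:cube k | PiM {..<k} (\<lambda>_. lborel).
        \<omega> (chart_at M (\<sigma> t)) (\<sigma> t) (\<lambda>i. partial_deriv (\<lambda>u. snd (chart_at M (\<sigma> t)) (\<sigma> u)) i t))"

definition reduction ::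
    "('m, 'n::finite) riemannian \<Rightarrow> ('c, 'm) cell_complex \<Rightarrow> 'c set \<Rightarrow> nat \<Rightarrow> ('m, 'n) form
      \<Rightarrow> ('c \<Rightarrow> real) \<Rightarrow> real" where
  "reduction M D S k \<omega> = (\<lambda>x.
     if x \<in> chains D S k then \<Sum>\<sigma>\<in>S. x \<sigma> * cell_integral M k (param D \<sigma>) \<omega> else 0)"

definition reconstruction ::
    "('m, 'n::finite) riemannian \<Rightarrow> ('c, 'm) cell_complex \<Rightarrow> 'c set
      \<Rightarrow> (nat \<Rightarrow> (('c \<Rightarrow> real) \<Rightarrow> real) \<Rightarrow> ('m, 'n) form) \<Rightarrow> bool" where
  "reconstruction M D S I \<longleftrightarrow>
     (\<forall>k. \<forall>f \<in> cochains D S k. I k f \<in> forms M k) \<and>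
     (\<forall>k. \<forall>f \<in> cochains D S k. \<forall>g \<in> cochains D S k.
        I k (\<lambda>x. f x + g x) = form_add (I k f) (I k g)) \<and>
     (\<forall>k. \<forall>f \<in> cochains D S k. \<forall>r. I k (\<lambda>x. r * f x) = form_scale r (I k f)) \<and>
     (\<forall>k. \<forall>f \<in> cochains D S k. reduction M D S k (I k f) = f) \<and>
     (\<forall>k. \<forall>f \<in> cochains D S k. ext_deriv M k (I k f) = I (Suc k) (coboundary D S k f))"

definition projection ::
    "('m, 'n::finite) riemannian \<Rightarrow> ('c, 'm) cell_complex \<Rightarrow> 'c set
      \<Rightarrow> (nat \<Rightarrow> (('c \<Rightarrow> real) \<Rightarrow> real) \<Rightarrow> ('m, 'n) form) \<Rightarrow> nat \<Rightarrow> ('m, 'n) form \<Rightarrow> ('m, 'n) form" where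
  "projection M D S I k a = I k (reduction M D S k a)"

text \<open>
  The coprojection belonging to a family \<open>P\<close> of projections. The coprojection of one complex is
  formed with the projection of the dual complex.
\<close>

definition coprojection ::
    "('m, 'n::{finite,linorder}) riemannian \<Rightarrow> (nat \<Rightarrow> ('m, 'n) form \<Rightarrow> ('m, 'n) form)
      \<Rightarrow> nat \<Rightarrow> ('m, 'n) form \<Rightarrow> ('m, 'n) form" where
  "coprojection M P k a =
     form_scale ((- 1) ^ (k * (CARD('n) - k)))
       (hodge_star M (CARD('n) - k) (P (CARD('n) - k) (hodge_star M k a)))"

end

theory Submission
  imports Defs "HOL-Combinatorics.Permutations"
begin

text \<open>
  Write \<open>n\<close> for the dimension, \<open>\<pi>\<close> for the projection belonging to the complex and \<open>A = \<star>a\<close>. Since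
  \<open>\<pi>\<close> is linear and commutes with \<open>d\<close>, and the two stars cancel up to a sign, both sides of the
  claim equal \<open>\<plusminus> \<star> d \<pi> A\<close>, the sign being that of the codifferential. Two points need work.
  First, \<open>\<star>\<star> = (- 1)^(k * (n - k))\<close> has to be proved, with the star characterised only by
  \<open>a \<and> \<star>b = (a, b) w\<close>; it follows from \<open>(a, \<star>b) w = b \<and> a\<close> and graded commutativity. Second,
  \<open>\<pi> d A = d \<pi> A\<close> is only available for smooth forms \<open>A\<close> compatible with changes of charts, so
  the star must preserve these. Of \<open>d A\<close>, in contrast, only the pointwise alternation is needed.
\<close>

section \<open>Multilinear and alternating forms\<close>

text \<open>The \<open>THE\<close> in \<open>hodge_star\<close> says nothing about how \<star>b
  varies from point to point or from chart to chart. It is therefore replaced by an explicit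
  formula, \<open>star_form\<close>. Existence and uniqueness both rest on one identity: a wedged
  with the contraction of \<open>det_form\<close> by u is a(u) times \<open>det_form\<close>. It
  yields the defining equation of the star and, with the factors exchanged, shows that wedge
  products detect every value of a form. Smoothness of \<star>b is then a matter of square roots,
  determinants and inverse matrices, and compatibility with charts is a computation with the
  Jacobian.

  The usual proof that dA is again in \<open>forms\<close> uses the symmetry of second derivatives
  of the transition maps. The argument here avoids it: Stokes' theorem is applied to A, and dA
  itself only passes through \<star>\<star>, scalar factors and the projection.\<close>

definition multilinear :: "nat \<Rightarrow> ((nat \<Rightarrow> 'v::real_vector) \<Rightarrow> real) \<Rightarrow> bool" where
  "multilinear k f \<longleftrightarrow>
     (\<forall>v v'. (\<forall>i<k. v i = v' i) \<longrightarrow> f v = f v') \<and>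
     (\<forall>v. \<forall>i<k. linear (\<lambda>x. f (v(i := x))))"

lemma alternating_iff:
  "alternating k f \<longleftrightarrow> multilinear k f \<and> (\<forall>v. \<forall>i<k. \<forall>j<k. i \<noteq> j \<and> v i = v j \<longrightarrow> f v = 0)"
  by (auto simp: alternating_def multilinear_def)

lemma alternating_multilinear: "alternating k f \<Longrightarrow> multilinear k f"
  by (simp add: alternating_iff)

lemma multilinear_cong: "multilinear k f \<Longrightarrow> (\<And>i. i < k \<Longrightarrow> v i = v' i) \<Longrightarrow> f v = f v'"
  unfolding multilinear_def by blast

lemma multilinear_linear: "multilinear k f \<Longrightarrow> i < k \<Longrightarrow> linear (\<lambda>x. f (v(i := x)))"
  unfolding multilinear_def by blast

lemma alternating_eq_0:
  "alternating k f \<Longrightarrow> i < k \<Longrightarrow> j < k \<Longrightarrow> i \<noteq> j \<Longrightarrow> v i = v j \<Longrightarrow> f v = 0"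
  unfolding alternating_def by blast

lemma sum_PiE_lessThan_Suc:
  "(\<Sum>I\<in>{..<Suc j} \<rightarrow>\<^sub>E A. g I) = (\<Sum>y\<in>A. \<Sum>I\<in>{..<j} \<rightarrow>\<^sub>E A. g (I(j := y)))"
proof -
  have "(\<Sum>I\<in>{..<Suc j} \<rightarrow>\<^sub>E A. g I) =
      (\<Sum>(y, I)\<in>A \<times> ({..<j} \<rightarrow>\<^sub>E A). g (I(j := y)))"
    unfolding lessThan_Suc PiE_insert_eq
    by (subst sum.reindex[OF inj_combinator]) (auto simp: case_prod_unfold)
  then show ?thesis
    by (simp add: sum.cartesian_product)
qed

lemma multilinear_expand:
  fixes w :: "nat \<Rightarrow> 'j::finite \<Rightarrow> 'v::real_vector"
  assumes f: "multilinear k f"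
  shows "f (\<lambda>m. \<Sum>j\<in>UNIV. c m j *\<^sub>R w m j) =
    (\<Sum>I\<in>{..<k} \<rightarrow>\<^sub>E UNIV. (\<Prod>m<k. c m (I m)) * f (\<lambda>m. w m (I m)))"
proof -
  \<comment> \<open>Induction on the number j of expanded slots. The other slots hold an arbitrary
    \<open>u\<close>, so that the vector chosen for slot j can be moved into \<open>u\<close> before
    the induction hypothesis is applied.\<close>
  have "f (\<lambda>m. if m < j then \<Sum>j\<in>UNIV. c m j *\<^sub>R w m j else u m) =
      (\<Sum>I\<in>{..<j} \<rightarrow>\<^sub>E UNIV. (\<Prod>m<j. c m (I m)) * f (\<lambda>m. if m < j then w m (I m) else u m))"
    if "j \<le> k" for j u
    using that
  proof (induction j arbitrary: u)
    case (Suc j)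
    let ?s = "\<lambda>m. \<Sum>j\<in>UNIV. c m j *\<^sub>R w m j"
    have "(\<lambda>m. if m < Suc j then ?s m else u m) =
        (\<lambda>m. if m < j then ?s m else u m)(j := ?s j)"
      by (auto simp: less_Suc_eq)
    moreover have lin: "linear (\<lambda>x. f ((\<lambda>m. if m < j then ?s m else u m)(j := x)))"
      using f Suc.prems by (intro multilinear_linear) auto
    ultimately have "f (\<lambda>m. if m < Suc j then ?s m else u m) =
        (\<Sum>y\<in>UNIV. c j y * f ((\<lambda>m. if m < j then ?s m else u m)(j := w j y)))"
      by (simp only: linear_sum[OF lin] linear_scale[OF lin] real_scaleR_def)
    also have "\<dots> = (\<Sum>y\<in>UNIV. c j y * f (\<lambda>m. if m < j then ?s m else (u(j := w j y)) m))"
      by (intro sum.cong refl arg_cong2[where f = "(*)"] arg_cong[where f = f]) auto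
    also have "\<dots> = (\<Sum>y\<in>UNIV. c j y * (\<Sum>I\<in>{..<j} \<rightarrow>\<^sub>E UNIV. (\<Prod>m<j. c m (I m)) *
        f (\<lambda>m. if m < j then w m (I m) else (u(j := w j y)) m)))"
      using Suc by simp
    also have "\<dots> = (\<Sum>y\<in>UNIV. \<Sum>I\<in>{..<j} \<rightarrow>\<^sub>E UNIV. (\<Prod>m<Suc j. c m ((I(j := y)) m)) *
        f (\<lambda>m. if m < Suc j then w m ((I(j := y)) m) else u m))"
      unfolding sum_distrib_left
      by (intro sum.cong refl)
         (auto simp: mult_ac less_Suc_eq intro!: arg_cong2[where f = "(*)"] arg_cong[where f = f])
    finally show ?case
      by (simp only: sum_PiE_lessThan_Suc)
  qed simp
  from this[of k "\<lambda>_. 0"] have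
    "f (\<lambda>m. if m < k then \<Sum>j\<in>UNIV. c m j *\<^sub>R w m j else 0) =
      (\<Sum>I\<in>{..<k} \<rightarrow>\<^sub>E UNIV. (\<Prod>m<k. c m (I m)) * f (\<lambda>m. if m < k then w m (I m) else 0))"
    by simp
  moreover have "f (\<lambda>m. if m < k then u m else 0) = f u" for u
    by (rule multilinear_cong[OF f]) simp
  ultimately show ?thesis
    by simp
qed

lemma multilinear_expand_axis:
  fixes v :: "nat \<Rightarrow> real^'n"
  assumes "multilinear k f"
  shows "f v = (\<Sum>I\<in>{..<k} \<rightarrow>\<^sub>E UNIV. (\<Prod>m<k. v m $ I m) * f (\<lambda>m. axis (I m) 1))"
  using multilinear_expand[OF assms, of "\<lambda>m j. v m $ j" "\<lambda>m j. axis j 1"]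
  by (simp add: basis_expansion flip: scalar_mult_eq_scaleR)

text \<open>Polarisation: f vanishes when slots i and j both contain \<open>v i + v j\<close>, and
  expanding leaves only the two mixed terms. Vanishing is required for this one pair only, so that
  the lemma applies before f is known to be alternating.\<close>

lemma alternating_transpose:
  assumes f: "multilinear k f" and ij: "i < k" "j < k" "i \<noteq> j"
    and zero: "\<And>v. v i = v j \<Longrightarrow> f v = 0"
  shows "f (\<lambda>m. v (Transposition.transpose i j m)) = - f v"
proof -
  let ?g = "\<lambda>x y. f (v(i := x, j := y))"
  have li: "linear (\<lambda>x. ?g x y)" for y
    using multilinear_linear[OF f ij(1), of "v(j := y)"] ij by (simp add: fun_upd_twist)
  have lj: "linear (?g x)" for x
    using multilinear_linear[OF f ij(2)] by blast
  have z: "?g x x = 0" for x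
    using ij by (intro zero) auto
  have "?g (v i + v j) (v i + v j) = ?g (v i) (v i) + ?g (v i) (v j) + (?g (v j) (v i) + ?g (v j) (v j))"
    by (simp only: linear_add[OF li] linear_add[OF lj])
  then have "?g (v j) (v i) = - ?g (v i) (v j)"
    unfolding z by linarith
  moreover have "v(i := v j, j := v i) = (\<lambda>m. v (Transposition.transpose i j m))"
    by (auto simp: Transposition.transpose_def)
  ultimately show ?thesis
    by simp
qed

lemma alternating_permutes:
  assumes f: "alternating k f" and p: "p permutes {..<k}"
  shows "f (\<lambda>i. v (p i)) = of_int (sign p) * f v"
  using p finite_lessThan
proof (induction arbitrary: v rule: permutes_induct)
  case (swap a b p)
  have "f (\<lambda>i. v ((Transposition.transpose a b \<circ> p) i)) = of_int (sign p) * f (\<lambda>i. v (Transposition.transpose a b i))"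
    using swap.IH[of "\<lambda>i. v (Transposition.transpose a b i)"] by simp
  moreover have "f (\<lambda>i. v (Transposition.transpose a b i)) = - f v"
    using swap by (intro alternating_transpose[OF alternating_multilinear[OF f]])
      (auto intro: alternating_eq_0[OF f])
  moreover have "sign (Transposition.transpose a b \<circ> p) = - sign p"
    using swap by (subst sign_compose)
      (auto simp: sign_swap_id permutation_swap_id intro: permutes_imp_permutation[OF finite_lessThan])
  ultimately show ?case
    by (simp only: of_int_minus mult_minus_left mult_minus_right)
qed simp

text \<open>Equal arguments are brought next to each other by swaps of neighbours, each of which
  only changes the sign. The criterion suits the exterior derivative, whose terms cancel visibly
  when the equal arguments are adjacent.\<close>

lemma adjacent_alternating:
  assumes f: "multilinear k f" and adj: "\<And>v i. Suc i < k \<Longrightarrow> v i = v (Suc i) \<Longrightarrow> f v = 0"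
  shows "alternating k f"
proof -
  have *: "f v = 0" if "i + Suc d < k" "v i = v (i + Suc d)" for v i d
    using that
  proof (induction d arbitrary: v)
    case (Suc d)
    \<comment> \<open>The second of the equal arguments moves one position towards i, so that the
      induction hypothesis applies to the permuted v.\<close>
    let ?t = "Transposition.transpose (i + Suc d) (i + Suc (Suc d))"
    have "f (\<lambda>m. v (?t m)) = - f v"
      using Suc.prems by (intro alternating_transpose[OF f]) (auto intro!: adj)
    moreover have "f (\<lambda>m. v (?t m)) = 0"
      using Suc.prems by (intro Suc.IH) (auto simp: Transposition.transpose_def)
    ultimately show ?case
      by simp
  qed (auto intro: adj)
  have "f v = 0" if "i < k" "j < k" "i \<noteq> j" "v i = v j" for v i j
    using *[of i "j - i - 1" v] *[of j "i - j - 1" v] that by (cases "i < j") auto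
  then show ?thesis
    using f by (auto simp: alternating_iff)
qed

section \<open>Antisymmetrisation, tensor products and interior products\<close>

definition antisymmetrize :: "nat \<Rightarrow> ((nat \<Rightarrow> 'v) \<Rightarrow> real) \<Rightarrow> (nat \<Rightarrow> 'v) \<Rightarrow> real" where
  "antisymmetrize n F v = (\<Sum>p | p permutes {..<n}. of_int (sign p) * F (\<lambda>i. v (p i)))"

lemma antisymmetrize_permutes:
  assumes q: "q permutes {..<n}"
  shows "antisymmetrize n F (\<lambda>i. v (q i)) = of_int (sign q) * antisymmetrize n F v"
proof -
  have "sign (q \<circ> p) = sign q * sign p" if "p permutes {..<n}" for p
    using q that by (intro sign_compose) (auto intro: permutes_imp_permutation[OF finite_lessThan])
  then have "antisymmetrize n F v = (\<Sum>p | p permutes {..<n}.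
      of_int (sign q) * (of_int (sign p) * F (\<lambda>i. v (q (p i)))))"
    unfolding antisymmetrize_def
    by (subst setum_permutations_compose_left[OF q]) (auto intro!: sum.cong)
  also have "\<dots> = of_int (sign q) * antisymmetrize n F (\<lambda>i. v (q i))"
    by (simp add: antisymmetrize_def sum_distrib_left)
  finally show ?thesis
    by (simp flip: mult.assoc of_int_mult)
qed

lemma alternating_antisymmetrize:
  assumes F: "multilinear n F"
  shows "alternating n (antisymmetrize n F)"
  unfolding alternating_def
proof (intro conjI allI impI)
  fix v v' :: "nat \<Rightarrow> 'a" assume "\<forall>i<n. v i = v' i"
  then show "antisymmetrize n F v = antisymmetrize n F v'"
    unfolding antisymmetrize_def
    by (intro sum.cong refl arg_cong2[where f = "(*)"] multilinear_cong[OF F])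
       (auto dest: permutes_in_image[where x = _ and S = "{..<n}"])
next
  fix v :: "nat \<Rightarrow> 'a" and i assume i: "i < n"
  have "linear (\<lambda>x. of_int (sign p) * F (\<lambda>j. (v(i := x)) (p j)))" if p: "p permutes {..<n}" for p
  proof -
    have "(\<lambda>j. (v(i := x)) (p j)) = (\<lambda>j. v (p j))(inv p i := x)" for x
      by (rule ext) (auto simp: permutes_inverses[OF p])
    moreover have "inv p i < n"
      using i permutes_in_image[OF permutes_inv[OF p], of i] by simp
    ultimately have "linear (\<lambda>x. F (\<lambda>j. (v(i := x)) (p j)))"
      using multilinear_linear[OF F] by presburger
    from linear_compose_scale_right[OF this] show ?thesis
      by simp
  qed
  then show "linear (\<lambda>x. antisymmetrize n F (v(i := x)))"
    unfolding antisymmetrize_def by (intro linear_compose_sum) auto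
next
  fix v :: "nat \<Rightarrow> 'a" and i j assume i: "i < n" "j < n" and ij: "i \<noteq> j \<and> v i = v j"
  have "(\<lambda>m. v (Transposition.transpose i j m)) = v"
    using ij by (auto simp: Transposition.transpose_def)
  then show "antisymmetrize n F v = 0"
    using antisymmetrize_permutes[OF permutes_swap_id[of i "{..<n}" j], of F v] i ij
    by (simp add: sign_swap_id)
qed

text \<open>As functions of y, the forms \<open>f (join k u y)\<close> are the interior products of
  f with u 0, ..., u (k - 1); all contractions are written in this way.\<close>

definition join :: "nat \<Rightarrow> (nat \<Rightarrow> 'v) \<Rightarrow> (nat \<Rightarrow> 'v) \<Rightarrow> nat \<Rightarrow> 'v" where
  "join k x y = (\<lambda>i. if i < k then x i else y (i - k))"

text \<open>The antisymmetriser turns this tensor product into a wedge product. Tensor products of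
  alternating forms are in general only multilinear, hence the separate notion
  \<open>multilinear\<close>.\<close>

lemma multilinear_tensor:
  assumes a: "multilinear k a" and b: "multilinear l b"
  shows "multilinear (k + l) (\<lambda>v. a v * b (\<lambda>i. v (k + i)))"
  unfolding multilinear_def
proof (intro conjI allI impI)
  fix v v' :: "nat \<Rightarrow> 'a" assume "\<forall>i<k + l. v i = v' i"
  then show "a v * b (\<lambda>i. v (k + i)) = a v' * b (\<lambda>i. v' (k + i))"
    by (intro arg_cong2[where f = "(*)"] multilinear_cong[OF a] multilinear_cong[OF b]) auto
next
  fix v :: "nat \<Rightarrow> 'a" and i assume i: "i < k + l"
  show "linear (\<lambda>x. a (v(i := x)) * b (\<lambda>m. (v(i := x)) (k + m)))"
  proof (cases "i < k")
    case True
    then have "(\<lambda>m. (v(i := x)) (k + m)) = (\<lambda>m. v (k + m))" for x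
      by auto
    then show ?thesis
      using linear_compose_scale_right[OF multilinear_linear[OF a True], of "b (\<lambda>m. v (k + m))" v]
      by (simp add: mult.commute)
  next
    case False
    then have "(\<lambda>m. (v(i := x)) (k + m)) = (\<lambda>m. v (k + m))(i - k := x)" for x
      by (auto simp: fun_eq_iff)
    moreover have "a (v(i := x)) = a v" for x
      using False by (intro multilinear_cong[OF a]) auto
    moreover have "i - k < l"
      using i False by simp
    ultimately show ?thesis
      using linear_compose_scale_right[OF multilinear_linear[OF b]] by simp
  qed
qed

lemma alternating_scale: "alternating k f \<Longrightarrow> alternating k (\<lambda>v. c * f v)"
  unfolding alternating_def
  by (auto intro: linear_compose_scale_right[where 'b = real, simplified])

lemma alternating_add: "alternating k f \<Longrightarrow> alternating k g \<Longrightarrow> alternating k (\<lambda>v. f v + g v)"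
  unfolding alternating_def
  by (auto intro!: linear_compose_add arg_cong2[where f = "(+)"])

lemma alternating_zero: "alternating k (\<lambda>v. 0)"
  unfolding alternating_def by (auto simp: linear_iff)

lemma alternating_sum: "(\<And>i. i \<in> A \<Longrightarrow> alternating k (f i)) \<Longrightarrow> alternating k (\<lambda>v. \<Sum>i\<in>A. f i v)"
  by (induction A rule: infinite_finite_induct) (auto intro: alternating_zero alternating_add)

lemma alternating_join_right:
  assumes f: "alternating (k + l) f"
  shows "alternating l (\<lambda>y. f (join k u y))"
  unfolding alternating_def
proof (intro conjI allI impI)
  fix v v' :: "nat \<Rightarrow> 'a" assume "\<forall>i<l. v i = v' i"
  then show "f (join k u v) = f (join k u v')"
    by (intro multilinear_cong[OF alternating_multilinear[OF f]]) (auto simp: join_def)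
next
  fix v :: "nat \<Rightarrow> 'a" and i assume i: "i < l"
  have "join k u (v(i := x)) = (join k u v)(k + i := x)" for x
    by (auto simp: join_def fun_eq_iff)
  then show "linear (\<lambda>x. f (join k u (v(i := x))))"
    using multilinear_linear[OF alternating_multilinear[OF f], of "k + i"] i by simp
next
  fix v :: "nat \<Rightarrow> 'a" and i j assume "i < l" "j < l" "i \<noteq> j \<and> v i = v j"
  then show "f (join k u v) = 0"
    by (intro alternating_eq_0[OF f, of "k + i" "k + j"]) (auto simp: join_def)
qed

lemma alternating_join_left:
  assumes f: "alternating (k + l) f"
  shows "alternating k (\<lambda>x. f (join k x u))"
  unfolding alternating_def
proof (intro conjI allI impI)
  fix v v' :: "nat \<Rightarrow> 'a" assume "\<forall>i<k. v i = v' i"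
  then show "f (join k v u) = f (join k v' u)"
    by (intro arg_cong[where f = f]) (auto simp: join_def)
next
  fix v :: "nat \<Rightarrow> 'a" and i assume i: "i < k"
  have "join k (v(i := x)) u = (join k v u)(i := x)" for x
    using i by (auto simp: join_def fun_eq_iff)
  then show "linear (\<lambda>x. f (join k (v(i := x)) u))"
    using multilinear_linear[OF alternating_multilinear[OF f], of i] i by simp
next
  fix v :: "nat \<Rightarrow> 'a" and i j assume "i < k" "j < k" "i \<noteq> j \<and> v i = v j"
  then show "f (join k v u) = 0"
    by (intro alternating_eq_0[OF f, of i j]) (auto simp: join_def)
qed

section \<open>The wedge product\<close>

lemma wedge_eq_antisymmetrize:
  "wedge k l a b v = antisymmetrize (k + l) (\<lambda>v. a v * b (\<lambda>i. v (k + i))) v / (fact k * fact l)"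
  by (simp add: wedge_def antisymmetrize_def mult.assoc)

lemma alternating_wedge:
  assumes "alternating k a" "alternating l b"
  shows "alternating (k + l) (wedge k l a b)"
proof -
  have "wedge k l a b = (\<lambda>v. 1 / (fact k * fact l) *
      antisymmetrize (k + l) (\<lambda>v. a v * b (\<lambda>i. v (k + i))) v)"
    by (simp add: wedge_eq_antisymmetrize fun_eq_iff)
  then show ?thesis
    by (simp only:) (intro alternating_scale alternating_antisymmetrize multilinear_tensor
        alternating_multilinear assms)
qed

text \<open>The exchange of a block of k positions with the following block of l positions; its
  inverse is \<open>rotation l k\<close>.\<close>

definition rotation :: "nat \<Rightarrow> nat \<Rightarrow> nat \<Rightarrow> nat" where
  "rotation k l i = (if i < k then l + i else if i < k + l then i - k else i)"

lemma rotation_permutes: "rotation k l permutes {..<k + l}"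
proof (rule bij_imp_permutes)
  show "bij_betw (rotation k l) {..<k + l} {..<k + l}"
    by (rule bij_betw_byWitness[where f' = "rotation l k"]) (auto simp: rotation_def)
qed (auto simp: rotation_def)

lemma sign_rotation: "sign (rotation k l) = (- 1) ^ (k * l)"
proof (induction k)
  case 0
  have "rotation 0 l = id"
    by (auto simp: rotation_def)
  then show ?case
    by simp
next
  case (Suc k)
  \<comment> \<open>The cycle that carries position k to k + l and shifts the l positions after k
    down by one. It moves the last entry of the first block past the second block, at the cost of l
    transpositions, and \<open>rotation k l\<close> moves the others.\<close>
  let ?c = "\<lambda>l i. if i = k then k + l else if k < i \<and> i \<le> k + l then i - 1 else i"
  have c: "permutation (?c l) \<and> sign (?c l) = (- 1) ^ l" for l
  proof (induction l)
    case 0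
    have "?c 0 = id"
      by auto
    then show ?case
      by simp
  next
    case (Suc l)
    have "?c (Suc l) = Transposition.transpose (k + l) (k + Suc l) \<circ> ?c l"
      by (rule ext) (auto simp: Transposition.transpose_def split: if_splits)
    then show ?case
      using Suc by (simp add: permutation_compose permutation_swap_id sign_compose sign_swap_id)
  qed
  have "rotation (Suc k) l = rotation k l \<circ> ?c l"
    by (rule ext) (auto simp: rotation_def)
  moreover have "permutation (rotation k l)"
    using rotation_permutes by (rule permutes_imp_permutation[OF finite_lessThan])
  ultimately show ?case
    using c[of l] Suc by (simp only: sign_compose) (simp add: power_add)
qed

lemma wedge_commute:
  assumes a: "multilinear k a" and b: "multilinear l b"
  shows "wedge k l a b v = (- 1) ^ (k * l) * wedge l k b a v"
proof -
  have sgn: "sign (p \<circ> rotation k l) = (- 1) ^ (k * l) * sign p" if "p permutes {..<k + l}" for p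
    using that rotation_permutes[of k l]
    by (subst sign_compose) (auto simp: sign_rotation intro: permutes_imp_permutation[OF finite_lessThan])
  have "(\<Sum>p | p permutes {..<k + l}. of_int (sign p) * a (\<lambda>i. v (p i)) * b (\<lambda>i. v (p (k + i)))) =
    (\<Sum>p | p permutes {..<k + l}. of_int (sign (p \<circ> rotation k l)) *
      a (\<lambda>i. v (p (rotation k l i))) * b (\<lambda>i. v (p (rotation k l (k + i)))))"
    by (subst sum_permutations_compose_right[OF rotation_permutes[of k l]]) simp
  also have "\<dots> = (\<Sum>p | p permutes {..<k + l}. (- 1) ^ (k * l) *
      (of_int (sign p) * b (\<lambda>i. v (p i)) * a (\<lambda>i. v (p (l + i)))))"
  proof (intro sum.cong refl)
    fix p assume "p \<in> {p. p permutes {..<k + l}}"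
    moreover have "a (\<lambda>i. v (p (rotation k l i))) = a (\<lambda>i. v (p (l + i)))"
      by (intro multilinear_cong[OF a]) (auto simp: rotation_def)
    moreover have "b (\<lambda>i. v (p (rotation k l (k + i)))) = b (\<lambda>i. v (p i))"
      by (intro multilinear_cong[OF b]) (auto simp: rotation_def)
    ultimately show "of_int (sign (p \<circ> rotation k l)) *
      a (\<lambda>i. v (p (rotation k l i))) * b (\<lambda>i. v (p (rotation k l (k + i)))) =
      (- 1) ^ (k * l) * (of_int (sign p) * b (\<lambda>i. v (p i)) * a (\<lambda>i. v (p (l + i))))"
      using sgn by simp
  qed
  finally show ?thesis
    by (simp add: wedge_def add.commute[of l k] mult.commute flip: sum_distrib_left)
qed

lemma join_rotation: "i < k + l \<Longrightarrow> join k x y i = join l y x (rotation k l i)"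
  by (auto simp: join_def rotation_def)

lemma alternating_join_commute:
  assumes "alternating (k + l) f"
  shows "f (join k x y) = (- 1) ^ (k * l) * f (join l y x)"
proof -
  have "f (join k x y) = f (\<lambda>i. join l y x (rotation k l i))"
    by (intro multilinear_cong[OF alternating_multilinear[OF assms]]) (simp add: join_rotation)
  then show ?thesis
    using alternating_permutes[OF assms rotation_permutes] by (simp add: sign_rotation)
qed

text \<open>Only permutations preserving the first block contribute: otherwise \<open>f\<close> sees a vector twice.\<close>

lemma wedge_contraction:
  assumes a: "alternating k a" and f: "alternating (k + l) f"
  shows "wedge k l a (\<lambda>y. f (join k w y)) w = a w * f w"
proof -
  let ?n = "k + l"
  \<comment> \<open>A permutation preserving the first block is uniquely the composition of a
    permutation \<rho> of this block and a permutation \<tau> of the other one.\<close>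
  let ?S = "{\<rho>. \<rho> permutes {..<k}} \<times> {\<tau>. \<tau> permutes {k..<?n}}"
  let ?c = "\<lambda>(\<rho>, \<tau>). \<rho> \<circ> \<tau>"
  let ?t = "\<lambda>p. of_int (sign p) * a (\<lambda>i. w (p i)) * f (join k w (\<lambda>i. w (p (k + i))))"
  have sub: "\<rho> permutes {..<?n}" "\<tau> permutes {..<?n}"
    if "\<rho> permutes {..<k}" "\<tau> permutes {k..<?n}" for \<rho> \<tau>
    using that by (auto intro: permutes_subset)
  have \<rho>_id: "\<rho> i = i" if "\<rho> permutes {..<k}" "k \<le> i" for \<rho> i
    using that by (auto simp: permutes_def)
  have \<tau>_id: "\<tau> i = i" if "\<tau> permutes {k..<?n}" "i < k" for \<tau> i
    using that by (auto simp: permutes_def)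
  have \<tau>_ge: "k \<le> \<tau> i" if "\<tau> permutes {k..<?n}" "k \<le> i" for \<tau> i
    using that permutes_in_image[OF that(1), of i] permutes_not_in[OF that(1), of i]
    by (cases "i < ?n") auto
  have inj: "inj_on ?c ?S"
  proof (rule inj_onI, clarify)
    fix \<rho> \<tau> \<rho>' \<tau>' assume *: "\<rho> permutes {..<k}" "\<tau> permutes {k..<?n}"
      "\<rho>' permutes {..<k}" "\<tau>' permutes {k..<?n}" and eq: "\<rho> \<circ> \<tau> = \<rho>' \<circ> \<tau>'"
    have "\<rho> i = \<rho>' i \<and> \<tau> i = \<tau>' i" for i
      using fun_cong[OF eq, of i] \<rho>_id[OF *(1)] \<rho>_id[OF *(3)] \<tau>_id[OF *(2)] \<tau>_id[OF *(4)]
        \<tau>_ge[OF *(2)] \<tau>_ge[OF *(4)] by (cases "i < k") auto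
    then show "\<rho> = \<rho>' \<and> \<tau> = \<tau>'"
      by auto
  qed
  have zero: "?t p = 0" if p: "p permutes {..<?n}" and np: "p \<notin> ?c ` ?S" for p
  proof -
    \<comment> \<open>If no position of the second block went into the first, p would preserve both
      blocks, because they are finite, and would factor through \<open>?S\<close>.\<close>
    have "\<exists>i\<in>{k..<?n}. p i < k"
    proof (rule ccontr)
      assume "\<not> ?thesis"
      then have ge: "p i \<in> {k..<?n}" if "i \<in> {k..<?n}" for i
        using that permutes_in_image[OF p, of i] by force
      have pinj: "inj p"
        using p by (rule permutes_inj)
      have im: "p ` {k..<?n} = {k..<?n}"
        using ge pinj by (intro endo_inj_surj) (auto intro: inj_on_subset)
      have lt: "p i < k" if "i < k" for i
      proof (rule ccontr)
        assume "\<not> p i < k"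
        then have "p i \<in> p ` {k..<?n}"
          using that permutes_in_image[OF p, of i] im by auto
        then show False
          using that by (simp add: inj_image_mem_iff[OF pinj])
      qed
      define \<rho> where "\<rho> = (\<lambda>i. if i < k then p i else i)"
      define \<tau> where "\<tau> = (\<lambda>i. if i < k then i else p i)"
      have "p ` {..<k} = {..<k}"
        using lt pinj by (intro endo_inj_surj) (auto intro: inj_on_subset)
      then have "\<rho> permutes {..<k}"
        by (intro bij_imp_permutes)
           (auto simp: \<rho>_def bij_betw_def inj_on_def inj_eq[OF pinj] cong: image_cong_simp)
      moreover have "\<tau> permutes {k..<?n}"
        using im permutes_not_in[OF p]
        by (intro bij_imp_permutes)
           (auto simp: \<tau>_def bij_betw_def inj_on_def inj_eq[OF pinj] cong: image_cong_simp)
      moreover have "p = \<rho> \<circ> \<tau>"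
      proof
        fix i
        show "p i = (\<rho> \<circ> \<tau>) i"
          using ge[of i] permutes_not_in[OF p, of i] by (cases "i < ?n") (auto simp: \<rho>_def \<tau>_def)
      qed
      ultimately show False
        using np by auto
    qed
    then obtain i where i: "k \<le> i" "i < ?n" "p i < k"
      by auto
    have "f (join k w (\<lambda>i. w (p (k + i)))) = 0"
      using i by (intro alternating_eq_0[OF f, of "p i" i]) (auto simp: join_def)
    then show ?thesis
      by simp
  qed
  \<comment> \<open>\<open>a\<close> contributes the sign of \<rho> and \<open>f\<close> that of
    \<tau>; together they cancel the sign of the permutation. All k! l! remaining terms are thus
    equal, which matches the normalisation of \<open>wedge\<close>.\<close>
  have val: "?t (?c x) = a w * f w" if x: "x \<in> ?S" for x
  proof -
    obtain \<rho> \<tau> where x_eq: "x = (\<rho>, \<tau>)" and *: "\<rho> permutes {..<k}" "\<tau> permutes {k..<?n}"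
      using x by auto
    have "a (\<lambda>i. w (\<rho> (\<tau> i))) = a (\<lambda>i. w (\<rho> i))"
      using \<tau>_id[OF *(2)] by (intro multilinear_cong[OF alternating_multilinear[OF a]]) simp
    then have a_eq: "a (\<lambda>i. w (\<rho> (\<tau> i))) = of_int (sign \<rho>) * a w"
      using alternating_permutes[OF a *(1)] by simp
    have "f (join k w (\<lambda>i. w (\<rho> (\<tau> (k + i))))) = f (\<lambda>i. w (\<tau> i))"
      using \<tau>_id[OF *(2)] \<tau>_ge[OF *(2)] \<rho>_id[OF *(1)]
      by (intro arg_cong[where f = f]) (auto simp: join_def)
    then have f_eq: "f (join k w (\<lambda>i. w (\<rho> (\<tau> (k + i))))) = of_int (sign \<tau>) * f w"
      using alternating_permutes[OF f sub(2)[OF *]] by simp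
    have "sign (\<rho> \<circ> \<tau>) = sign \<rho> * sign \<tau>"
      using sub[OF *] by (intro sign_compose) (auto intro: permutes_imp_permutation[OF finite_lessThan])
    moreover have "real_of_int (sign \<rho>) * real_of_int (sign \<rho>) = 1" "real_of_int (sign \<tau>) * real_of_int (sign \<tau>) = 1"
      by (simp_all flip: of_int_mult)
    ultimately show ?thesis
      using a_eq f_eq by (simp add: x_eq) (simp add: mult_ac)
  qed
  have "(\<Sum>p | p permutes {..<?n}. ?t p) = (\<Sum>p\<in>?c ` ?S. ?t p)"
  proof (rule sum.mono_neutral_right)
    show "?c ` ?S \<subseteq> {p. p permutes {..<?n}}"
      using sub by (auto intro!: permutes_compose)
    show "\<forall>p\<in>{p. p permutes {..<?n}} - ?c ` ?S. ?t p = 0"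
      using zero by blast
  qed (simp add: finite_permutations)
  also have "\<dots> = (\<Sum>x\<in>?S. a w * f w)"
    by (rule sum.reindex_cong[OF inj refl]) (rule val)
  also have "\<dots> = fact k * fact l * (a w * f w)"
    by (simp add: card_cartesian_product card_permutations)
  finally show ?thesis
    by (simp add: wedge_def)
qed

section \<open>Forms in coordinates\<close>

text \<open>The notation \<open>real^'n\<close> would impose the sort \<open>finite\<close> on \<open>'n\<close> and clash with \<open>linorder\<close>.\<close>

type_synonym 'n rvec = "(real, 'n) vec"
type_synonym 'n rmat = "('n rvec, 'n) vec"

abbreviation frame :: "(nat \<Rightarrow> 'n::finite) \<Rightarrow> nat \<Rightarrow> 'n rvec" where
  "frame I \<equiv> \<lambda>m. axis (I m) 1"

text \<open>Enumerates the indices in increasing order, so \<open>frame index_at\<close> is the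
  standard, positively oriented basis. Values at positions from \<open>CARD('n)\<close> on are
  unspecified.\<close>

definition index_at :: "nat \<Rightarrow> 'n::{finite,linorder}" where
  "index_at = inv index_rank"

lemma bij_betw_index_rank: "bij_betw index_rank (UNIV :: 'n set) {..<CARD('n::{finite,linorder})}"
proof -
  have "index_rank i < index_rank j" if "i < j" for i j :: 'n
    unfolding index_rank_def using that by (intro psubset_card_mono) auto
  then have inj: "inj (index_rank :: 'n \<Rightarrow> nat)"
    by (metis injI less_irrefl linorder_neqE)
  have "index_rank i < CARD('n)" for i :: 'n
    unfolding index_rank_def by (intro psubset_card_mono) auto
  then have "range (index_rank :: 'n \<Rightarrow> nat) = {..<CARD('n)}"
    using inj by (intro card_subset_eq) (auto simp: card_image)
  with inj show ?thesis
    by (simp add: bij_betw_def)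
qed

lemma index_rank_less: "index_rank (i :: 'n::{finite,linorder}) < CARD('n)"
  using bij_betw_index_rank[where 'n = 'n] by (auto simp: bij_betw_def)

lemma index_at_rank [simp]: "index_at (index_rank i) = i"
  unfolding index_at_def using bij_betw_index_rank by (metis bij_betw_def inv_f_f)

lemma index_rank_at [simp]: "m < CARD('n) \<Longrightarrow> index_rank (index_at m :: 'n::{finite,linorder}) = m"
  using bij_betw_index_rank[where 'n = 'n] by (metis bij_betw_def imageE index_at_rank lessThan_iff)

section \<open>Forms of top degree and their contractions\<close>

definition det_form :: "(nat \<Rightarrow> ('n::{finite,linorder}) rvec) \<Rightarrow> real" where
  "det_form v = det (\<chi> i. v (index_rank i))"

lemma volume_eq: "volume G v = sqrt (det G) * det_form v"
  by (simp add: volume_def det_form_def)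

lemma alternating_det_form:
  "alternating CARD('n) (det_form :: (nat \<Rightarrow> ('n::{finite,linorder}) rvec) \<Rightarrow> real)"
  unfolding alternating_def
proof (intro conjI allI impI)
  fix v v' :: "nat \<Rightarrow> 'n rvec" assume "\<forall>i<CARD('n). v i = v' i"
  then show "det_form v = det_form v'"
    by (simp add: det_form_def index_rank_less)
next
  fix v :: "nat \<Rightarrow> 'n rvec" and m assume m: "m < CARD('n)"
  have eq: "det_form (v(m := x)) = det (\<chi> i. if i = index_at m then x else v (index_rank i))" for x
    unfolding det_form_def
    by (rule arg_cong[where f = det]) (use m in \<open>auto simp: vec_eq_iff\<close>)
  show "linear (\<lambda>x. det_form (v(m := x)))"
    unfolding eq
    by (rule linearI)
       (simp_all add: det_row_add
         det_row_mul[of "index_at m" _ "\<lambda>_. _" "\<lambda>i. v (index_rank i)", unfolded scalar_mult_eq_scaleR])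
next
  fix v :: "nat \<Rightarrow> 'n rvec" and i j assume "i < CARD('n)" "j < CARD('n)" and ij: "i \<noteq> j \<and> v i = v j"
  then have "index_at i \<noteq> (index_at j :: 'n)"
    by (metis index_rank_at)
  then show "det_form v = 0"
    unfolding det_form_def
    by (rule det_identical_rows) (use ij \<open>i < _\<close> \<open>j < _\<close> in \<open>simp add: row_def vec_eq_iff\<close>)
qed

lemma det_form_frame [simp]: "det_form (frame index_at :: nat \<Rightarrow> ('n::{finite,linorder}) rvec) = 1"
proof -
  have "(\<chi> i. frame index_at (index_rank i)) = (mat 1 :: 'n rmat)"
    by (auto simp: vec_eq_iff mat_def axis_def)
  then show ?thesis
    unfolding det_form_def by simp
qed

lemma det_form_matrix:
  fixes T :: "('n::{finite,linorder}) rmat"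
  shows "det_form (\<lambda>i. T *v v i) = det T * det_form v"
proof -
  have "(\<chi> i::'n. T *v v (index_rank i)) = (\<chi> i. v (index_rank i)) ** transpose T"
    by (auto simp: vec_eq_iff matrix_matrix_mult_def matrix_vector_mult_def transpose_def mult.commute)
  then show ?thesis
    unfolding det_form_def by (simp only: det_mul det_transpose mult.commute)
qed

text \<open>The positions from k on are filled by any bijection between complements of equal size. A
  permutation of the whole basis is wanted because the later identities evaluate forms of
  complementary degrees on the same basis.\<close>

lemma frame_permutation:
  fixes I :: "nat \<Rightarrow> 'n::{finite,linorder}"
  assumes I: "inj_on I {..<k}"
  obtains q where "q permutes {..<CARD('n)}" "\<And>m. m < k \<Longrightarrow> index_at (q m) = I m"
proof -
  have k: "k \<le> CARD('n)"
    using card_mono[OF finite, of "I ` {..<k}" UNIV] by (simp add: card_image[OF I])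
  let ?J = "(index_rank \<circ> I) ` {..<k}"
  have inj: "inj_on (index_rank \<circ> I) {..<k}"
    using I bij_betw_index_rank[where 'n = 'n]
    by (intro comp_inj_on) (auto simp: bij_betw_def intro: inj_on_subset)
  have J: "?J \<subseteq> {..<CARD('n)}"
    by (auto simp: index_rank_less)
  have "card ({..<CARD('n)} - {..<k}) = card ({..<CARD('n)} - ?J)"
    using k card_Diff_subset[OF _ J] card_image[OF inj] by (simp add: card_Diff_subset)
  then obtain h where h: "bij_betw h ({..<CARD('n)} - {..<k}) ({..<CARD('n)} - ?J)"
    using finite_same_card_bij by (metis finite_Diff finite_lessThan)
  define q where "q m = (if m < k then index_rank (I m) else if m < CARD('n) then h m else m)" for m
  have "bij_betw q {..<k} ?J"
    using inj by (auto simp: bij_betw_def q_def inj_on_def)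
  moreover have "bij_betw q ({..<CARD('n)} - {..<k}) ({..<CARD('n)} - ?J)"
    using h by (rule bij_betw_cong[THEN iffD1, rotated]) (auto simp: q_def)
  ultimately have "bij_betw q ({..<k} \<union> ({..<CARD('n)} - {..<k})) (?J \<union> ({..<CARD('n)} - ?J))"
    by (rule bij_betw_combine) auto
  moreover have "{..<k} \<union> ({..<CARD('n)} - {..<k}) = {..<CARD('n)}" "?J \<union> ({..<CARD('n)} - ?J) = {..<CARD('n)}"
    using k J by auto
  ultimately have "q permutes {..<CARD('n)}"
    using k by (intro bij_imp_permutes) (auto simp: q_def)
  then show thesis
    by (rule that) (simp add: q_def)
qed

text \<open>Only basis tuples without repetition matter, and these extend to permutations of the
  basis. In degrees above the dimension there are none, and both forms vanish.\<close>

lemma alternating_eqI: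
  fixes f g :: "(nat \<Rightarrow> ('n::{finite,linorder}) rvec) \<Rightarrow> real"
  assumes f: "alternating k f" and g: "alternating k g"
    and eq: "\<And>q. q permutes {..<CARD('n)} \<Longrightarrow> f (frame (\<lambda>m. index_at (q m))) = g (frame (\<lambda>m. index_at (q m)))"
  shows "f v = g v"
proof -
  have "f (frame I) = g (frame I)" for I :: "nat \<Rightarrow> 'n"
  proof (cases "inj_on I {..<k}")
    case True
    then obtain q where q: "q permutes {..<CARD('n)}" "\<And>m. m < k \<Longrightarrow> index_at (q m) = I m"
      by (rule frame_permutation) blast
    have h: "h (frame I) = h (frame (\<lambda>m. index_at (q m)))" if "alternating k h" for h :: "(nat \<Rightarrow> 'n rvec) \<Rightarrow> real"
      by (intro multilinear_cong[OF alternating_multilinear[OF that]]) (simp add: q)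
    show ?thesis
      using eq[OF q(1)] h[OF f] h[OF g] by simp
  next
    case False
    then obtain i j where "i < k" "j < k" "i \<noteq> j" "I i = I j"
      by (auto simp: inj_on_def)
    then show ?thesis
      using alternating_eq_0[OF f, of i j] alternating_eq_0[OF g, of i j] by simp
  qed
  then show ?thesis
    by (simp add: multilinear_expand_axis[OF alternating_multilinear[OF f], of v]
        multilinear_expand_axis[OF alternating_multilinear[OF g], of v])
qed

lemma top_form_eq:
  fixes F :: "(nat \<Rightarrow> ('n::{finite,linorder}) rvec) \<Rightarrow> real"
  assumes F: "alternating CARD('n) F"
  shows "F v = F (frame index_at) * det_form v"
proof (rule alternating_eqI[OF F alternating_scale[OF alternating_det_form]])
  fix q assume "q permutes {..<CARD('n)}"
  from alternating_permutes[OF F this, of "frame index_at"]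
    alternating_permutes[OF alternating_det_form this, of "frame index_at :: nat \<Rightarrow> 'n rvec"]
  show "F (frame (\<lambda>m. index_at (q m))) = F (frame index_at) * det_form (frame (\<lambda>m. index_at (q m) :: 'n))"
    by simp
qed

text \<open>\<open>det_form (frame L)\<close> is the Levi-Civita symbol: a sign if L is an ordering
  of the basis, and 0 if an index repeats. This converts the sum over permutations in a wedge
  product into the sums over index tuples that occur in \<open>form_inner\<close>.\<close>

lemma antisymmetrize_frame:
  fixes F :: "(nat \<Rightarrow> ('n::{finite,linorder}) rvec) \<Rightarrow> real"
  assumes F: "multilinear CARD('n) F"
  shows "antisymmetrize CARD('n) F (frame index_at) =
    (\<Sum>L\<in>{..<CARD('n)} \<rightarrow>\<^sub>E UNIV. det_form (frame L) * F (frame L))"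
proof -
  let ?n = "CARD('n)"
  let ?P = "{p. p permutes {..<?n}}"
  let ?L = "\<lambda>p. \<lambda>m\<in>{..<?n}. index_at (p m) :: 'n"
  have cong: "F (frame (?L p)) = F (frame (\<lambda>m. index_at (p m)))" for p
    by (intro multilinear_cong[OF F]) simp
  have det: "det_form (frame (?L p)) = of_int (sign p)" if "p permutes {..<?n}" for p
  proof -
    have "det_form (frame (?L p)) = det_form (frame (\<lambda>m. index_at (p m) :: 'n))"
      by (rule multilinear_cong[OF alternating_multilinear[OF alternating_det_form]]) simp
    then show ?thesis
      using alternating_permutes[OF alternating_det_form that, of "frame index_at :: nat \<Rightarrow> 'n rvec"]
      by (simp only: det_form_frame mult_1_right)
  qed
  have inj: "inj_on ?L ?P"
  proof (rule inj_onI, rule ext)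
    fix p q m assume "p \<in> ?P" "q \<in> ?P" and eq: "?L p = ?L q"
    then have p: "p permutes {..<?n}" and q: "q permutes {..<?n}"
      by auto
    show "p m = q m"
    proof (cases "m < ?n")
      case True
      then have "index_rank (index_at (p m) :: 'n) = index_rank (index_at (q m) :: 'n)"
        using fun_cong[OF eq, of m] by simp
      then show ?thesis
        using True permutes_in_image[OF p, of m] permutes_in_image[OF q, of m] by simp
    next
      case False
      then show ?thesis
        using permutes_not_in[OF p] permutes_not_in[OF q] by simp
    qed
  qed
  have "antisymmetrize ?n F (frame index_at) = (\<Sum>p\<in>?P. det_form (frame (?L p)) * F (frame (?L p)))"
    unfolding antisymmetrize_def by (intro sum.cong refl) (simp only: cong det mem_Collect_eq)
  also have "\<dots> = (\<Sum>L\<in>?L ` ?P. det_form (frame L) * F (frame L))"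
    by (simp only: sum.reindex[OF inj] o_def)
  also have "\<dots> = (\<Sum>L\<in>{..<?n} \<rightarrow>\<^sub>E UNIV. det_form (frame L) * F (frame L))"
  proof (intro sum.mono_neutral_left ballI)
    fix L :: "nat \<Rightarrow> 'n" assume L: "L \<in> ({..<?n} \<rightarrow>\<^sub>E UNIV) - ?L ` ?P"
    have "\<not> inj_on L {..<?n}"
    proof
      assume "inj_on L {..<?n}"
      then obtain q where q: "q permutes {..<?n}" "\<And>m. m < ?n \<Longrightarrow> index_at (q m) = L m"
        by (rule frame_permutation) blast
      have "L = ?L q"
        using L q(2) by (intro ext) (simp add: PiE_def extensional_def)
      with q(1) have "q \<in> ?P" "L = ?L q"
        by simp_all
      with L show False
        by blast
    qed
    then obtain i j where "i < ?n" "j < ?n" "i \<noteq> j" "L i = L j"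
      by (auto simp: inj_on_def)
    then show "det_form (frame L) * F (frame L) = 0"
      using alternating_eq_0[OF alternating_det_form, of i j "frame L"] by simp
  next
    show "?L ` ?P \<subseteq> {..<?n} \<rightarrow>\<^sub>E UNIV"
      by (intro image_subsetI iffD2[OF restrict_PiE_iff]) simp
  qed (simp add: finite_PiE)
  finally show ?thesis .
qed

text \<open>Both sides are alternating in u and of top degree in v, so it suffices to take the
  standard basis for v and a permuted one for u. The identity is what makes contractions of the
  volume form solve the equation that defines the star.\<close>

lemma wedge_interior_det_form:
  fixes a :: "(nat \<Rightarrow> ('n::{finite,linorder}) rvec) \<Rightarrow> real"
  assumes a: "alternating k a" and kl: "k + l = CARD('n)"
  shows "wedge k l a (\<lambda>y. det_form (join k u y)) v = a u * det_form v"
proof -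
  have alt: "alternating (k + l) (det_form :: (nat \<Rightarrow> 'n rvec) \<Rightarrow> real)"
    using alternating_det_form kl by simp
  have W: "alternating (k + l) (wedge k l a (\<lambda>y. det_form (join k u y)))" for u
    by (intro alternating_wedge a alternating_join_right alt)
  have "wedge k l a (\<lambda>y. det_form (join k u y)) (frame index_at) = a u"
  proof (rule alternating_eqI[of k])
    show "alternating k (\<lambda>u. wedge k l a (\<lambda>y. det_form (join k u y)) (frame index_at))"
      unfolding wedge_def
      by (subst divide_inverse, subst mult.commute)
         (intro alternating_scale alternating_sum alternating_join_left[OF alt])
  next
    fix q assume q: "q permutes {..<CARD('n)}"
    let ?w = "frame (\<lambda>m. index_at (q m)) :: nat \<Rightarrow> 'n rvec"
    \<comment> \<open>\<open>wedge_contraction\<close> needs the same vectors in the contraction and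
      as arguments. Returning to the standard basis in the arguments costs \<open>sign q\<close>,
      which \<open>det_form ?w\<close> compensates.\<close>
    have "wedge k l a (\<lambda>y. det_form (join k ?w y)) ?w = a ?w * det_form ?w"
      by (rule wedge_contraction[OF a alt])
    moreover have "wedge k l a (\<lambda>y. det_form (join k ?w y)) ?w =
        of_int (sign q) * wedge k l a (\<lambda>y. det_form (join k ?w y)) (frame index_at)"
      using q kl by (intro alternating_permutes[OF W]) simp
    moreover have "det_form ?w = of_int (sign q)"
      using alternating_permutes[OF alternating_det_form q, of "frame index_at :: nat \<Rightarrow> 'n rvec"] by simp
    ultimately show "wedge k l a (\<lambda>y. det_form (join k ?w y)) (frame index_at) = a ?w"
      by simp
  qed (rule a)
  then show ?thesis
    using top_form_eq[OF W[unfolded kl], of u v] by simp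
qed

lemma wedge_scale_right: "wedge k l a (\<lambda>x. c * f x) v = c * wedge k l a f v"
  unfolding wedge_def
  by (simp only: mult.left_commute[of _ c] sum_distrib_left[symmetric] times_divide_eq_right)

text \<open>Exchanging the factors of the wedge product and exchanging the blocks inside
  \<open>det_form\<close> each cost \<open>(- 1) ^ (k * l)\<close>, so no sign remains.\<close>

lemma wedge_det_form_interior:
  fixes f :: "(nat \<Rightarrow> ('n::{finite,linorder}) rvec) \<Rightarrow> real"
  assumes f: "alternating l f" and kl: "k + l = CARD('n)"
  shows "wedge k l (\<lambda>x. det_form (join k x u)) f v = f u * det_form v"
proof -
  have alt: "alternating (k + l) (det_form :: (nat \<Rightarrow> 'n rvec) \<Rightarrow> real)"
    using alternating_det_form kl by simp
  have "wedge k l (\<lambda>x. det_form (join k x u)) f v =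
      (- 1) ^ (k * l) * wedge l k f (\<lambda>x. det_form (join k x u)) v"
    by (intro wedge_commute alternating_multilinear f alternating_join_left[OF alt])
  also have "wedge l k f (\<lambda>x. det_form (join k x u)) v =
      wedge l k f (\<lambda>x. (- 1) ^ (k * l) * det_form (join l u x)) v"
    by (simp only: alternating_join_commute[OF alt])
  also have "\<dots> = (- 1) ^ (k * l) * wedge l k f (\<lambda>x. det_form (join l u x)) v"
    by (rule wedge_scale_right)
  also have "wedge l k f (\<lambda>x. det_form (join l u x)) v = f u * det_form v"
    using kl by (intro wedge_interior_det_form f) simp
  finally show ?thesis
    by (simp only: mult.assoc[symmetric] power_mult_distrib[symmetric]) (simp only: minus_mult_minus mult_1_right power_one mult_1_left)
qed

lemma sum_PiE_join:
  fixes k l :: nat and g :: "(nat \<Rightarrow> 'a) \<Rightarrow> (nat \<Rightarrow> 'a) \<Rightarrow> 'b::comm_monoid_add"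
  shows "(\<Sum>J\<in>{..<k} \<rightarrow>\<^sub>E A. \<Sum>I\<in>{..<l} \<rightarrow>\<^sub>E A. g J I) =
    (\<Sum>L\<in>{..<k + l} \<rightarrow>\<^sub>E A. g (restrict L {..<k}) (\<lambda>i\<in>{..<l}. L (k + i)))"
  unfolding sum.cartesian_product
proof (rule sum.reindex_bij_witness[where
      i = "\<lambda>L. (restrict L {..<k}, \<lambda>i\<in>{..<l}. L (k + i))" and
      j = "\<lambda>(J, I). restrict (join k J I) {..<k + l}"])
  fix x assume "x \<in> ({..<k} \<rightarrow>\<^sub>E A) \<times> ({..<l} \<rightarrow>\<^sub>E A)"
  then obtain J I where x: "x = (J, I)" and J: "J \<in> {..<k} \<rightarrow>\<^sub>E A" and I: "I \<in> {..<l} \<rightarrow>\<^sub>E A"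
    by auto
  have r: "restrict (restrict (join k J I) {..<k + l}) {..<k} = J"
    using J by (intro ext) (auto simp: join_def PiE_def extensional_def)
  have s: "(\<lambda>i\<in>{..<l}. restrict (join k J I) {..<k + l} (k + i)) = I"
    using I by (intro ext) (auto simp: join_def PiE_def extensional_def)
  show "(\<lambda>L. (restrict L {..<k}, \<lambda>i\<in>{..<l}. L (k + i)))
      ((\<lambda>(J, I). restrict (join k J I) {..<k + l}) x) = x"
    using r s by (simp add: x)
  show "(\<lambda>(J, I). restrict (join k J I) {..<k + l}) x \<in> {..<k + l} \<rightarrow>\<^sub>E A"
    using I J by (auto simp: x join_def PiE_def Pi_def)
  show "g (restrict ((\<lambda>(J, I). restrict (join k J I) {..<k + l}) x) {..<k})
      (\<lambda>i\<in>{..<l}. (\<lambda>(J, I). restrict (join k J I) {..<k + l}) x (k + i)) = (\<lambda>(x, y). g x y) x"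
    using r s by (simp add: x)
next
  fix L assume L: "L \<in> {..<k + l} \<rightarrow>\<^sub>E A"
  show "(\<lambda>(J, I). restrict (join k J I) {..<k + l}) (restrict L {..<k}, \<lambda>i\<in>{..<l}. L (k + i)) = L"
    using L by (intro ext) (auto simp: join_def PiE_def extensional_def)
  show "(restrict L {..<k}, \<lambda>i\<in>{..<l}. L (k + i)) \<in> ({..<k} \<rightarrow>\<^sub>E A) \<times> ({..<l} \<rightarrow>\<^sub>E A)"
    using L by (auto simp: PiE_def Pi_def)
qed

section \<open>The Hodge star on a single vector space\<close>

lemma matrix_inv_inverse:
  fixes A :: "'a::semiring_1^'n^'m"
  assumes "invertible A"
  shows "A ** matrix_inv A = mat 1" "matrix_inv A ** A = mat 1"
  using someI_ex[OF assms[unfolded invertible_def]] unfolding matrix_inv_def by auto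

lemma matrix_inv_unique:
  fixes A :: "'a::semiring_1^'n^'n"
  assumes "B ** A = mat 1" "A ** B = mat 1"
  shows "matrix_inv A = B"
proof -
  have "invertible A"
    using assms unfolding invertible_def by blast
  then have "matrix_inv A = B ** A ** matrix_inv A"
    using assms by simp
  also have "\<dots> = B"
    using matrix_inv_inverse(1)[OF \<open>invertible A\<close>] by (simp flip: matrix_mul_assoc)
  finally show ?thesis .
qed

lemma transpose_matrix_inv_symmetric:
  fixes G :: "real^'n^'n"
  assumes sym: "transpose G = G" and inv: "invertible G"
  shows "transpose (matrix_inv G) = matrix_inv G"
proof (rule matrix_inv_unique[symmetric])
  have "transpose (G ** matrix_inv G) = mat 1" "transpose (matrix_inv G ** G) = mat 1"
    by (simp_all only: matrix_inv_inverse[OF inv] transpose_mat)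
  then show "transpose (matrix_inv G) ** G = mat 1" "G ** transpose (matrix_inv G) = mat 1"
    by (simp_all only: matrix_transpose_mul sym)
qed

text \<open>The vectors metrically dual to the coordinate differentials: inserting them into a form
  raises its indices.\<close>

abbreviation raised :: "('n::finite) rmat \<Rightarrow> (nat \<Rightarrow> 'n) \<Rightarrow> nat \<Rightarrow> 'n rvec" where
  "raised G J \<equiv> \<lambda>m. matrix_inv G *v axis (J m) 1"

lemma multilinear_matrix_axis:
  fixes A :: "real^'n^'m"
  assumes "multilinear k f"
  shows "f (\<lambda>m. A *v axis (J m) 1) = (\<Sum>I\<in>{..<k} \<rightarrow>\<^sub>E UNIV. (\<Prod>m<k. A $ I m $ J m) * f (frame I))"
  by (subst multilinear_expand_axis[OF assms]) (simp add: matrix_vector_mult_basis column_def)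

text \<open>The sum over I in \<open>form_inner\<close> is the expansion of a at the raised vectors,
  so the inverse metric moves into the arguments of a.\<close>

lemma form_inner_raised:
  assumes "multilinear k a"
  shows "form_inner k G a b = (\<Sum>J\<in>{..<k} \<rightarrow>\<^sub>E UNIV. a (raised G J) * b (frame J)) / fact k"
  unfolding form_inner_def multilinear_matrix_axis[OF assms] sum_distrib_right
  by (subst sum.swap) (rule refl)

lemma form_inner_commute:
  assumes "transpose (matrix_inv G) = matrix_inv G"
  shows "form_inner k G a b = form_inner k G b a"
proof -
  have "matrix_inv G $ i $ j = matrix_inv G $ j $ i" for i j
    by (subst assms[symmetric]) (simp add: transpose_def)
  then have prod: "(\<Prod>m<k. matrix_inv G $ I m $ J m) = (\<Prod>m<k. matrix_inv G $ J m $ I m)" for I J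
    by simp
  show ?thesis
    unfolding form_inner_def
    by (subst sum.swap, intro arg_cong2[where f = "(/)"] sum.cong refl, subst prod)
       (simp only: mult.assoc mult.commute[of "a _" "b _"])
qed

text \<open>The Hodge star is the contraction of the volume form with the form whose indices have been raised.\<close>

definition star_form ::
    "nat \<Rightarrow> ('n::{finite,linorder}) rmat \<Rightarrow> ((nat \<Rightarrow> 'n rvec) \<Rightarrow> real) \<Rightarrow> (nat \<Rightarrow> 'n rvec) \<Rightarrow> real" where
  "star_form k G b v =
    (\<Sum>J\<in>{..<k} \<rightarrow>\<^sub>E UNIV. sqrt (det G) / fact k * b (frame J) * det_form (join k (raised G J) v))"

lemma alternating_star_form:
  fixes G :: "('n::{finite,linorder}) rmat"
  assumes "k + l = CARD('n)"
  shows "alternating l (star_form k G b)"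
  unfolding star_form_def
  by (intro alternating_sum alternating_scale alternating_join_right)
     (use assms alternating_det_form[where 'n = 'n] in simp)

lemma wedge_sum_right:
  "wedge k l a (\<lambda>y. \<Sum>J\<in>A. c J * f J y) v = (\<Sum>J\<in>A. c J * wedge k l a (f J) v)"
proof -
  have "wedge k l a (\<lambda>y. \<Sum>J\<in>A. c J * f J y) v =
      (\<Sum>p | p permutes {..<k + l}. \<Sum>J\<in>A. c J * (of_int (sign p) * a (\<lambda>i. v (p i)) * f J (\<lambda>i. v (p (k + i)))))
        / (fact k * fact l)"
    unfolding wedge_def sum_distrib_left by (simp only: mult.left_commute)
  also have "\<dots> = (\<Sum>J\<in>A. c J * wedge k l a (f J) v)"
    by (subst sum.swap) (simp only: wedge_def sum_distrib_left sum_divide_distrib times_divide_eq_right)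
  finally show ?thesis .
qed

lemma wedge_star_form:
  fixes G :: "('n::{finite,linorder}) rmat"
  assumes a: "alternating k a" and kl: "k + l = CARD('n)"
  shows "wedge k l a (star_form k G b) v = form_inner k G a b * volume G v"
proof -
  have "wedge k l a (star_form k G b) v =
      (\<Sum>J\<in>{..<k} \<rightarrow>\<^sub>E UNIV. sqrt (det G) / fact k * b (frame J) * (a (raised G J) * det_form v))"
    unfolding star_form_def wedge_sum_right by (simp only: wedge_interior_det_form[OF a kl])
  also have "\<dots> = form_inner k G a b * volume G v"
    by (simp add: form_inner_raised[OF alternating_multilinear[OF a]] volume_eq sum_divide_distrib
        sum_distrib_left sum_distrib_right mult_ac)
  finally show ?thesis .
qed

text \<open>The test forms are contracted determinants, whose wedge products return the values of f
  and g. This settles uniqueness in the definition of the star, and later identifies \<star>\<star>b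
  from its wedge products.\<close>

lemma wedge_right_cancel:
  fixes f g :: "(nat \<Rightarrow> ('n::{finite,linorder}) rvec) \<Rightarrow> real"
  assumes f: "alternating l f" and g: "alternating l g" and kl: "k + l = CARD('n)"
    and eq: "\<And>a. alternating k a \<Longrightarrow> wedge k l a f = wedge k l a g"
  shows "f = g"
proof
  fix u :: "nat \<Rightarrow> 'n rvec"
  have "alternating k (\<lambda>x. det_form (join k x u))"
    by (rule alternating_join_left[of k l]) (use kl alternating_det_form[where 'n = 'n] in simp)
  from fun_cong[OF eq[OF this], of "frame index_at"] show "f u = g u"
    by (simp add: wedge_det_form_interior[OF f kl] wedge_det_form_interior[OF g kl])
qed

lemma hodge_star_eq_star_form:
  fixes M :: "('m, 'n::{finite,linorder}) riemannian"
  assumes "c \<in> atlas M" "p \<in> fst c" "k \<le> CARD('n)"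
  shows "hodge_star M k b c p = star_form k (metric M c p) (b c p)"
proof -
  have kl: "k + (CARD('n) - k) = CARD('n)"
    using assms by simp
  let ?P = "\<lambda>f. alternating (CARD('n) - k) f \<and> (\<forall>a. alternating k a \<longrightarrow>
      wedge k (CARD('n) - k) a f =
        (\<lambda>v. form_inner k (metric M c p) a (b c p) * volume (metric M c p) v))"
  have "The ?P = star_form k (metric M c p) (b c p)"
  proof (rule the_equality)
    show "?P (star_form k (metric M c p) (b c p))"
      using alternating_star_form[OF kl] by (simp add: wedge_star_form[OF _ kl] fun_eq_iff)
  next
    fix f assume "?P f"
    then show "f = star_form k (metric M c p) (b c p)"
      by (intro wedge_right_cancel[OF _ alternating_star_form[OF kl] kl])
         (auto simp: wedge_star_form[OF _ kl] fun_eq_iff)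
  qed
  then show ?thesis
    using assms by (simp add: hodge_star_def)
qed

text \<open>With the arguments of the inner product exchanged, the indices of \<star>b are raised.
  Then \<open>det_form\<close> receives raised vectors only and \<open>det (matrix_inv G)\<close>
  splits off. It cancels against two factors \<open>sqrt (det G)\<close>, one from the star and one
  from the volume form.\<close>

lemma form_inner_star_form:
  fixes G :: "('n::{finite,linorder}) rmat"
  assumes a: "alternating l a" and b: "alternating k b" and kl: "k + l = CARD('n)"
    and sym: "transpose G = G" and pos: "det G > 0"
  shows "form_inner l G a (star_form k G b) * volume G v = wedge k l b a v"
proof -
  have inv: "invertible G"
    using pos by (simp add: invertible_det_nz)
  have alt: "alternating (k + l) (det_form :: (nat \<Rightarrow> 'n rvec) \<Rightarrow> real)"
    using alternating_det_form[where 'n = 'n] kl by simp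
  have det_inv: "det (matrix_inv G) * det G = 1"
    using matrix_inv_inverse(2)[OF inv] det_mul[of "matrix_inv G" G] by simp
  have det_raised: "det_form (join k (raised G J) (raised G I)) =
      det (matrix_inv G) * det_form (join k (frame J) (frame I))" for I J :: "nat \<Rightarrow> 'n"
    unfolding det_form_matrix[symmetric] by (intro arg_cong[where f = det_form]) (auto simp: join_def)
  have "form_inner l G a (star_form k G b) = form_inner l G (star_form k G b) a"
    by (rule form_inner_commute[OF transpose_matrix_inv_symmetric[OF sym inv]])
  also have "\<dots> = (\<Sum>I\<in>{..<l} \<rightarrow>\<^sub>E UNIV. star_form k G b (raised G I) * a (frame I)) / fact l"
    by (intro form_inner_raised alternating_multilinear alternating_star_form kl)
  also have "\<dots> = sqrt (det G) * det (matrix_inv G) / (fact k * fact l) *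
      (\<Sum>I\<in>{..<l} \<rightarrow>\<^sub>E UNIV. \<Sum>J\<in>{..<k} \<rightarrow>\<^sub>E UNIV.
        det_form (join k (frame J) (frame I)) * (b (frame J) * a (frame I)))"
    unfolding star_form_def det_raised sum_divide_distrib sum_distrib_left sum_distrib_right
    by (intro sum.cong refl) (simp add: mult_ac)
  \<comment> \<open>The k indices J and the l indices I form one tuple L of length n, to which
    \<open>antisymmetrize_frame\<close> applies.\<close>
  also have "(\<Sum>I\<in>{..<l} \<rightarrow>\<^sub>E UNIV. \<Sum>J\<in>{..<k} \<rightarrow>\<^sub>E UNIV.
        det_form (join k (frame J) (frame I)) * (b (frame J) * a (frame I))) =
      (\<Sum>L\<in>{..<k + l} \<rightarrow>\<^sub>E UNIV. det_form (frame L) * (b (frame L) * a (\<lambda>i. frame L (k + i))))"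
  proof (subst sum.swap, subst sum_PiE_join, intro sum.cong refl arg_cong2[where f = "(*)"])
    fix L :: "nat \<Rightarrow> 'n"
    show "det_form (join k (frame (restrict L {..<k})) (frame (\<lambda>i\<in>{..<l}. L (k + i)))) = det_form (frame L)"
      by (rule multilinear_cong[OF alternating_multilinear[OF alt]]) (auto simp: join_def)
    show "b (frame (restrict L {..<k})) = b (frame L)"
      by (rule multilinear_cong[OF alternating_multilinear[OF b]]) simp
    show "a (frame (\<lambda>i\<in>{..<l}. L (k + i))) = a (\<lambda>i. frame L (k + i))"
      by (rule multilinear_cong[OF alternating_multilinear[OF a]]) simp
  qed
  also have "\<dots> = antisymmetrize (k + l) (\<lambda>v. b v * a (\<lambda>i. v (k + i))) (frame index_at)"
    using antisymmetrize_frame[of "\<lambda>v. b v * a (\<lambda>i. v (k + i))"]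
      multilinear_tensor[OF alternating_multilinear[OF b] alternating_multilinear[OF a]]
    by (simp add: kl)
  finally have "form_inner l G a (star_form k G b) =
      sqrt (det G) * det (matrix_inv G) * wedge k l b a (frame index_at)"
    by (simp add: wedge_eq_antisymmetrize)
  then have "form_inner l G a (star_form k G b) * volume G v =
      (sqrt (det G) * sqrt (det G)) * det (matrix_inv G) * (wedge k l b a (frame index_at) * det_form v)"
    by (simp add: volume_eq mult_ac)
  also have "\<dots> = wedge k l b a (frame index_at) * det_form v"
    using det_inv pos by (simp add: mult.commute)
  also have "\<dots> = wedge k l b a v"
    using alternating_wedge[OF b a] kl by (intro top_form_eq[symmetric]) simp
  finally show ?thesis .
qed

lemma star_form_star_form:
  fixes G :: "('n::{finite,linorder}) rmat"
  assumes b: "alternating k b" and kl: "k + l = CARD('n)"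
    and sym: "transpose G = G" and pos: "det G > 0"
  shows "star_form l G (star_form k G b) = (\<lambda>v. (- 1) ^ (k * l) * b v)"
proof (rule wedge_right_cancel[of k])
  have lk: "l + k = CARD('n)"
    using kl by simp
  show "l + k = CARD('n)" "alternating k (star_form l G (star_form k G b))"
      "alternating k (\<lambda>v. (- 1) ^ (k * l) * b v)"
    by (rule lk alternating_star_form[OF lk] alternating_scale[OF b])+
  fix a :: "(nat \<Rightarrow> 'n rvec) \<Rightarrow> real" assume a: "alternating l a"
  show "wedge l k a (star_form l G (star_form k G b)) = wedge l k a (\<lambda>v. (- 1) ^ (k * l) * b v)"
  proof
    fix v
    have "wedge l k a (star_form l G (star_form k G b)) v = wedge k l b a v"
      by (simp only: wedge_star_form[OF a lk] form_inner_star_form[OF a b kl sym pos])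
    also have "\<dots> = (- 1) ^ (k * l) * wedge l k a b v"
      by (intro wedge_commute alternating_multilinear a b)
    finally show "wedge l k a (star_form l G (star_form k G b)) v = wedge l k a (\<lambda>v. (- 1) ^ (k * l) * b v) v"
      by (simp only: wedge_scale_right)
  qed
qed

text \<open>The inverse metrics satisfy
  \<open>matrix_inv G' = T ** matrix_inv G ** transpose T\<close>, and
  \<open>sqrt (det G) = sqrt (det G') * det T\<close> since \<open>det T > 0\<close>. The factor
  \<open>det T\<close> is the one that \<open>det_form\<close> produces when all its arguments are
  mapped by T. With \<open>det T < 0\<close> the star would change sign, so this is where
  orientation enters.\<close>

lemma star_form_pullback:
  fixes G G' T :: "('n::{finite,linorder}) rmat"
  assumes b: "multilinear k b" and kl: "k + l = CARD('n)"
    and G: "G = transpose T ** G' ** T" and posT: "det T > 0" and pos: "det G' > 0"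
  shows "star_form k G (\<lambda>v. b (\<lambda>i. T *v v i)) v = star_form k G' b (\<lambda>i. T *v v i)"
proof -
  have det: "det G = det T * det T * det G'"
    by (simp add: G det_mul)
  then have sqrt: "sqrt (det G) = sqrt (det G') * det T"
    using posT by (simp add: real_sqrt_mult)
  have "det G > 0"
    using posT pos by (simp add: det)
  then have inv: "invertible G" "invertible T"
    using posT by (simp_all add: invertible_det_nz)
  obtain S where S: "T ** S = mat 1" "S ** T = mat 1"
    using inv(2) unfolding invertible_def by blast
  \<comment> \<open>\<open>T ** S\<close> is inserted to complete \<open>transpose T ** G'\<close>
    to G.\<close>
  have "T ** matrix_inv G ** transpose T ** G' = T ** matrix_inv G ** transpose T ** G' ** (T ** S)"
    by (simp add: S)
  also have "\<dots> = T ** (matrix_inv G ** G) ** S"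
    by (simp only: G matrix_mul_assoc)
  also have "\<dots> = mat 1"
    by (simp add: matrix_inv_inverse[OF inv(1)] S)
  finally have left: "T ** matrix_inv G ** transpose T ** G' = mat 1" .
  have inv': "matrix_inv G' = T ** matrix_inv G ** transpose T"
    by (rule matrix_inv_unique[OF left iffD1[OF matrix_left_right_inverse left]])
  have alt: "alternating k (\<lambda>x. det_form (join k x v))" for v :: "nat \<Rightarrow> 'n rvec"
    by (rule alternating_join_left[of k l]) (use kl alternating_det_form[where 'n = 'n] in simp)
  have raised: "T *v (\<Sum>j\<in>UNIV. T $ i $ j *\<^sub>R (matrix_inv G *v axis j 1)) = matrix_inv G' *v axis i 1" for i
  proof -
    have "(\<Sum>j\<in>UNIV. T $ i $ j *\<^sub>R (matrix_inv G *v axis j 1)) =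
        matrix_inv G *v (\<Sum>j\<in>UNIV. T $ i $ j *\<^sub>R axis j 1)"
      by (simp add: linear_sum[OF matrix_vector_mul_linear] linear_scale[OF matrix_vector_mul_linear])
    also have "(\<Sum>j\<in>UNIV. T $ i $ j *\<^sub>R axis j 1) = transpose T *v axis i 1"
      by (simp add: vec_eq_iff axis_def matrix_vector_mult_def transpose_def if_distrib cong: if_cong)
    finally show ?thesis
      by (simp only: inv' matrix_vector_mul_assoc matrix_mul_assoc)
  qed
  \<comment> \<open>The entries of T come from expanding the pulled-back b on the basis; the sum
    over J gathers them into the arguments of \<open>det_form\<close>.\<close>
  have expand: "(\<Sum>J\<in>{..<k} \<rightarrow>\<^sub>E UNIV. (\<Prod>m<k. T $ I m $ J m) * det_form (join k (raised G J) v)) * det T =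
      det_form (join k (raised G' I) (\<lambda>i. T *v v i))" for I :: "nat \<Rightarrow> 'n"
  proof -
    let ?x = "\<lambda>m. \<Sum>j\<in>UNIV. T $ I m $ j *\<^sub>R (matrix_inv G *v axis j 1)"
    have "(\<Sum>J\<in>{..<k} \<rightarrow>\<^sub>E UNIV. (\<Prod>m<k. T $ I m $ J m) * det_form (join k (raised G J) v)) * det T =
        det T * det_form (join k ?x v)"
      by (simp only: multilinear_expand[OF alternating_multilinear[OF alt]] mult.commute)
    also have "\<dots> = det_form (join k (raised G' I) (\<lambda>i. T *v v i))"
      unfolding det_form_matrix[symmetric]
      by (intro arg_cong[where f = det_form]) (auto simp: join_def raised)
    finally show ?thesis .
  qed
  have "star_form k G (\<lambda>v. b (\<lambda>i. T *v v i)) v =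
      (\<Sum>J\<in>{..<k} \<rightarrow>\<^sub>E UNIV. \<Sum>I\<in>{..<k} \<rightarrow>\<^sub>E UNIV. sqrt (det G') / fact k * b (frame I) *
        ((\<Prod>m<k. T $ I m $ J m) * det_form (join k (raised G J) v) * det T))"
    unfolding star_form_def sqrt multilinear_matrix_axis[OF b] sum_distrib_left sum_distrib_right
    by (intro sum.cong refl) (simp add: mult_ac)
  also have "\<dots> = (\<Sum>I\<in>{..<k} \<rightarrow>\<^sub>E UNIV. sqrt (det G') / fact k * b (frame I) *
      ((\<Sum>J\<in>{..<k} \<rightarrow>\<^sub>E UNIV. (\<Prod>m<k. T $ I m $ J m) * det_form (join k (raised G J) v)) * det T))"
    by (subst sum.swap) (simp only: sum_distrib_left sum_distrib_right)
  finally show ?thesis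
    by (simp only: expand star_form_def[of k G'])
qed

text \<open>Along the segment from the identity to G the quadratic form stays positive, so no matrix
  there is singular. The determinant is 1 at the identity and cannot change sign.\<close>

lemma det_pos_definite:
  fixes G :: "real^'n^'n"
  assumes pos: "\<And>v. v \<noteq> 0 \<Longrightarrow> v \<bullet> (G *v v) > 0"
  shows "det G > 0"
proof (rule ccontr)
  let ?A = "\<lambda>t. t *\<^sub>R G + (1 - t) *\<^sub>R mat 1 :: real^'n^'n"
  assume "\<not> det G > 0"
  moreover have "continuous_on {0..1} (\<lambda>t. det (?A t))"
    unfolding det_def by (intro continuous_intros)
  ultimately obtain t where t: "0 \<le> t" "t \<le> 1" "det (?A t) = 0"
    using IVT2'[of "\<lambda>t. det (?A t)" 1 0 0] by auto
  then have "\<not> invertible (?A t)"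
    by (simp only: invertible_det_nz not_not)
  then obtain v where v: "v \<noteq> 0" "?A t *v v = 0"
    unfolding invertible_left_inverse matrix_left_invertible_ker by blast
  have "v \<bullet> (?A t *v v) = t * (v \<bullet> (G *v v)) + (1 - t) * (v \<bullet> v)"
    by (simp add: matrix_vector_mult_add_rdistrib scaleR_matrix_vector_assoc[symmetric] inner_add_right)
  moreover have "\<dots> > 0"
  proof (cases "t = 0")
    case False
    then have "t * (v \<bullet> (G *v v)) > 0"
      using t pos[OF v(1)] by simp
    moreover have "(1 - t) * (v \<bullet> v) \<ge> 0"
      using t by simp
    ultimately show ?thesis
      by linarith
  qed (use v in simp)
  ultimately show False
    using v(2) by simp
qed

section \<open>Smoothness within charts\<close>

text \<open>
  A weak condition, met by the relatively open subsets of half-spaces onto which charts map, under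
  which derivatives within \<open>S\<close> are unique.
\<close>

definition axis_accessible :: "'a::euclidean_space set \<Rightarrow> bool" where
  "axis_accessible S \<longleftrightarrow> (\<forall>x\<in>S. \<forall>i\<in>Basis. \<forall>e>0. \<exists>d. 0 < \<bar>d\<bar> \<and> \<bar>d\<bar> < e \<and> x + d *\<^sub>R i \<in> S)"

lemma axis_accessible_half_space:
  assumes "openin (top_of_set {x. 0 \<le> x \<bullet> b}) S"
  shows "axis_accessible S"
  unfolding axis_accessible_def
proof (intro ballI allI impI)
  fix x i :: 'a and e :: real assume x: "x \<in> S" and i: "i \<in> Basis" and e: "e > 0"
  obtain r where r: "r > 0" "ball x r \<inter> {x. 0 \<le> x \<bullet> b} \<subseteq> S" and S: "S \<subseteq> {x. 0 \<le> x \<bullet> b}"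
    using assms x unfolding openin_contains_ball by blast
  \<comment> \<open>The sign keeps the step along i inside the half-space; the length keeps it
    inside the ball and below e.\<close>
  define d where "d = (if 0 \<le> i \<bullet> b then 1 else - 1) * (min r e / 2)"
  have d: "0 < \<bar>d\<bar>" "\<bar>d\<bar> < e" "\<bar>d\<bar> < r"
    using e r(1) by (auto simp: d_def abs_mult)
  have "0 \<le> d * (i \<bullet> b)"
    using e r(1) by (auto simp: d_def mult_le_0_iff)
  moreover have "0 \<le> x \<bullet> b"
    using S x by auto
  ultimately have "0 \<le> (x + d *\<^sub>R i) \<bullet> b"
    by (simp add: inner_add_left)
  moreover have "x + d *\<^sub>R i \<in> ball x r"
    using d(3) i by (simp add: dist_norm)
  ultimately show "\<exists>d. 0 < \<bar>d\<bar> \<and> \<bar>d\<bar> < e \<and> x + d *\<^sub>R i \<in> S"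
    using d r(2) by blast
qed

text \<open>\<open>frechet_derivative\<close> is a choice among possible derivatives. Where only one
  exists, it can be computed by the usual rules.\<close>

lemma frechet_derivative_within_eq:
  assumes "axis_accessible S" "x \<in> S" "(f has_derivative f') (at x within S)"
  shows "frechet_derivative f (at x within S) = f'"
proof (rule frechet_derivative_unique_within)
  show "(f has_derivative frechet_derivative f (at x within S)) (at x within S)"
    using differentiableI[OF assms(3)] by (rule iffD1[OF frechet_derivative_works])
qed (use assms in \<open>auto simp: axis_accessible_def\<close>)

lemma differentiable_on_has_derivative:
  "f differentiable_on S \<Longrightarrow> x \<in> S \<Longrightarrow>
    (f has_derivative frechet_derivative f (at x within S)) (at x within S)"
  unfolding differentiable_on_def by (blast intro: iffD1[OF frechet_derivative_works])

lemma has_derivative_within_cong: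
  assumes "\<And>y. y \<in> S \<Longrightarrow> f y = g y" "x \<in> S"
  shows "(f has_derivative F) (at x within S) \<longleftrightarrow> (g has_derivative F) (at x within S)"
  using has_derivative_transform[of x S f g F] has_derivative_transform[of x S g f F] assms by auto

lemma frechet_derivative_within_cong:
  assumes "\<And>y. y \<in> S \<Longrightarrow> f y = g y" "x \<in> S"
  shows "frechet_derivative f (at x within S) = frechet_derivative g (at x within S)"
  by (simp add: frechet_derivative_def has_derivative_within_cong[of S f g, OF assms])

lemma Ck_on_cong:
  assumes "\<And>x. x \<in> S \<Longrightarrow> f x = g x" "Ck_on m S f"
  shows "Ck_on m S g"
  using assms
proof (induction m arbitrary: f g)
  case 0
  then show ?case
    using continuous_on_cong[OF refl "0.prems"(1)] by simp
next
  case (Suc m)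
  have "f differentiable_on S \<longleftrightarrow> g differentiable_on S"
    unfolding differentiable_on_def differentiable_def
    using has_derivative_within_cong[of S f g, OF Suc.prems(1)] by blast
  moreover have "Ck_on m S (\<lambda>x. frechet_derivative g (at x within S) v)" for v
  proof (rule Suc.IH)
    show "frechet_derivative f (at x within S) v = frechet_derivative g (at x within S) v" if "x \<in> S" for x
      using frechet_derivative_within_cong[of S f g, OF Suc.prems(1) that] by simp
    show "Ck_on m S (\<lambda>x. frechet_derivative f (at x within S) v)"
      using Suc.prems(2) by simp
  qed
  ultimately show ?case
    using Suc.prems(2) by simp
qed

lemma Ck_on_SucI:
  assumes "axis_accessible S"
    and "\<And>x. x \<in> S \<Longrightarrow> (f has_derivative f' x) (at x within S)"
    and "\<And>v. Ck_on m S (\<lambda>x. f' x v)"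
  shows "Ck_on (Suc m) S f"
proof -
  have "Ck_on m S (\<lambda>x. frechet_derivative f (at x within S) v)" for v
    by (rule Ck_on_cong[OF _ assms(3)[of v]]) (simp add: frechet_derivative_within_eq[OF assms(1) _ assms(2)])
  moreover have "f differentiable_on S"
    using assms(2) unfolding differentiable_on_def differentiable_def by blast
  ultimately show ?thesis
    by simp
qed

lemma Ck_on_Suc_has_derivative:
  "Ck_on (Suc m) S f \<Longrightarrow> x \<in> S \<Longrightarrow>
    (f has_derivative frechet_derivative f (at x within S)) (at x within S)"
  by (rule differentiable_on_has_derivative) simp_all

lemma Ck_on_Suc_deriv:
  "Ck_on (Suc m) S f \<Longrightarrow> Ck_on m S (\<lambda>x. frechet_derivative f (at x within S) v)"
  by simp

lemma Ck_on_SucD: "Ck_on (Suc m) S f \<Longrightarrow> Ck_on m S f"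
proof (induction m arbitrary: f)
  case (Suc m)
  then have "f differentiable_on S" "Ck_on m S (\<lambda>x. frechet_derivative f (at x within S) v)" for v
    unfolding Ck_on.simps(2)[of "Suc m"] by blast+
  then show ?case
    by simp
qed (simp add: differentiable_imp_continuous_on)

lemma Ck_on_const:
  assumes "axis_accessible S"
  shows "Ck_on m S (\<lambda>_. c)"
proof (induction m arbitrary: c)
  case (Suc m)
  show ?case
    by (rule Ck_on_SucI[OF assms, where f' = "\<lambda>_ _. 0"]) (rule has_derivative_const, rule Suc.IH)
qed simp

lemma Ck_on_bounded_linear:
  assumes S: "axis_accessible S" and L: "bounded_linear L" and "Ck_on m S f"
  shows "Ck_on m S (\<lambda>x. L (f x))"
  using assms(3)
proof (induction m arbitrary: f)
  case 0
  then show ?case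
    using bounded_linear.continuous_on[OF L] by simp
next
  case (Suc m)
  show ?case
    by (rule Ck_on_SucI[OF S bounded_linear.has_derivative[OF L Ck_on_Suc_has_derivative[OF Suc.prems]]])
       (assumption, intro Suc.IH Ck_on_Suc_deriv[OF Suc.prems])
qed

lemma Ck_on_add:
  assumes S: "axis_accessible S" and "Ck_on m S f" "Ck_on m S g"
  shows "Ck_on m S (\<lambda>x. f x + g x)"
  using assms(2,3)
proof (induction m arbitrary: f g)
  case 0
  then show ?case
    by (simp add: continuous_on_add)
next
  case (Suc m)
  show ?case
    by (rule Ck_on_SucI[OF S has_derivative_add[OF Suc.prems[THEN Ck_on_Suc_has_derivative]]])
       (assumption+, intro Suc.IH Suc.prems[THEN Ck_on_Suc_deriv])
qed

lemma Ck_on_mult: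
  fixes f g :: "'a::euclidean_space \<Rightarrow> real"
  assumes S: "axis_accessible S" and "Ck_on m S f" "Ck_on m S g"
  shows "Ck_on m S (\<lambda>x. f x * g x)"
  using assms(2,3)
proof (induction m arbitrary: f g)
  case 0
  then show ?case
    by (simp add: continuous_on_mult)
next
  case (Suc m)
  show ?case
    by (rule Ck_on_SucI[OF S has_derivative_mult[OF Suc.prems[THEN Ck_on_Suc_has_derivative]]])
       (assumption+, intro Ck_on_add[OF S] Suc.IH Suc.prems[THEN Ck_on_Suc_deriv] Suc.prems[THEN Ck_on_SucD])
qed

text \<open>The derivative is built from 1/f and the derivative of f, so the induction on m closes:
  the induction hypothesis covers the factors 1/f. The square root below works in the same
  way.\<close>

lemma Ck_on_inverse:
  fixes f :: "'a::euclidean_space \<Rightarrow> real"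
  assumes S: "axis_accessible S" and "Ck_on m S f" and nz: "\<And>x. x \<in> S \<Longrightarrow> f x \<noteq> 0"
  shows "Ck_on m S (\<lambda>x. inverse (f x))"
  using assms(2)
proof (induction m)
  case 0
  then show ?case
    using nz by (simp add: continuous_on_inverse)
next
  case (Suc m)
  have IH: "Ck_on m S (\<lambda>x. inverse (f x))"
    by (rule Suc.IH[OF Ck_on_SucD[OF Suc.prems]])
  show ?case
  proof (rule Ck_on_SucI[OF S Deriv.has_derivative_inverse[OF nz Ck_on_Suc_has_derivative[OF Suc.prems]]])
    show "Ck_on m S (\<lambda>x. - (inverse (f x) * frechet_derivative f (at x within S) v * inverse (f x)))" for v
      by (intro Ck_on_bounded_linear[OF S bounded_linear_minus[OF bounded_linear_ident]]
          Ck_on_mult[OF S] IH Ck_on_Suc_deriv[OF Suc.prems])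
  qed
qed

lemma Ck_on_sqrt:
  fixes f :: "'a::euclidean_space \<Rightarrow> real"
  assumes S: "axis_accessible S" and "Ck_on m S f" and pos: "\<And>x. x \<in> S \<Longrightarrow> f x > 0"
  shows "Ck_on m S (\<lambda>x. sqrt (f x))"
  using assms(2)
proof (induction m)
  case 0
  then show ?case
    by (simp add: continuous_on_real_sqrt)
next
  case (Suc m)
  have IH: "Ck_on m S (\<lambda>x. sqrt (f x))"
    by (rule Suc.IH[OF Ck_on_SucD[OF Suc.prems]])
  have nz: "sqrt (f x) \<noteq> 0" if "x \<in> S" for x
    using pos[OF that] by simp
  show ?case
  proof (rule Ck_on_SucI[OF S has_derivative_real_sqrt[OF pos Ck_on_Suc_has_derivative[OF Suc.prems]]])
    show "Ck_on m S (\<lambda>x. frechet_derivative f (at x within S) v * (inverse (sqrt (f x)) / 2))" for v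
      unfolding divide_inverse
      by (intro Ck_on_mult[OF S] Ck_on_inverse[OF S IH nz] Ck_on_const[OF S] Ck_on_Suc_deriv[OF Suc.prems])
  qed
qed

lemma smooth_on_const: "axis_accessible S \<Longrightarrow> smooth_on S (\<lambda>_. c)"
  by (simp add: smooth_on_def Ck_on_const)

lemma smooth_on_cong: "(\<And>x. x \<in> S \<Longrightarrow> f x = g x) \<Longrightarrow> smooth_on S f \<Longrightarrow> smooth_on S g"
  unfolding smooth_on_def using Ck_on_cong by blast

lemma smooth_on_differentiable: "smooth_on S f \<Longrightarrow> f differentiable_on S"
  unfolding smooth_on_def by (metis Ck_on.simps(2))

lemma smooth_on_mult:
  fixes f g :: "'a::euclidean_space \<Rightarrow> real"
  shows "axis_accessible S \<Longrightarrow> smooth_on S f \<Longrightarrow> smooth_on S g \<Longrightarrow> smooth_on S (\<lambda>x. f x * g x)"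
  by (simp add: smooth_on_def Ck_on_mult)

lemma smooth_on_sum:
  fixes f :: "'i \<Rightarrow> 'a::euclidean_space \<Rightarrow> real"
  assumes "axis_accessible S" "\<And>i. i \<in> A \<Longrightarrow> smooth_on S (f i)"
  shows "smooth_on S (\<lambda>x. \<Sum>i\<in>A. f i x)"
  using assms(2)
  by (induction A rule: infinite_finite_induct)
     (auto intro: Ck_on_const[OF assms(1)] Ck_on_add[OF assms(1)] simp: smooth_on_def)

lemma smooth_on_prod:
  fixes f :: "'i \<Rightarrow> 'a::euclidean_space \<Rightarrow> real"
  assumes "axis_accessible S" "\<And>i. i \<in> A \<Longrightarrow> smooth_on S (f i)"
  shows "smooth_on S (\<lambda>x. \<Prod>i\<in>A. f i x)"
  using assms(2)
  by (induction A rule: infinite_finite_induct)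
     (auto intro: smooth_on_const[OF assms(1)] smooth_on_mult[OF assms(1)])

lemma smooth_on_det:
  fixes A :: "'a::euclidean_space \<Rightarrow> real^'n^'n"
  assumes "axis_accessible S" "\<And>i j. smooth_on S (\<lambda>x. A x $ i $ j)"
  shows "smooth_on S (\<lambda>x. det (A x))"
  unfolding det_def
  by (intro smooth_on_sum smooth_on_mult smooth_on_prod smooth_on_const assms)

text \<open>Cramer's rule leaves only determinants and one division, so that smoothness of the
  inverse metric follows from that of the metric.\<close>

lemma matrix_inv_cramer:
  fixes A :: "real^'n^'n"
  assumes "det A \<noteq> 0"
  shows "matrix_inv A $ i $ j = det (\<chi> r c. if c = i then axis j 1 $ r else A $ r $ c) * inverse (det A)"
proof -
  have "A *v (matrix_inv A *v axis j 1) = axis j 1"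
    using matrix_inv_inverse(1)[of A] assms by (simp add: matrix_vector_mul_assoc invertible_det_nz)
  then have "matrix_inv A *v axis j 1 = (\<chi> k. det (\<chi> r c. if c = k then axis j 1 $ r else A $ r $ c) / det A)"
    using cramer[OF assms] by blast
  then have "(matrix_inv A *v axis j 1) $ i = det (\<chi> r c. if c = i then axis j 1 $ r else A $ r $ c) / det A"
    by simp
  then show ?thesis
    by (simp add: matrix_vector_mult_basis column_def divide_inverse)
qed

lemma smooth_on_matrix_inv:
  fixes A :: "'a::euclidean_space \<Rightarrow> real^'n^'n"
  assumes S: "axis_accessible S" and A: "\<And>i j. smooth_on S (\<lambda>x. A x $ i $ j)"
    and nz: "\<And>x. x \<in> S \<Longrightarrow> det (A x) \<noteq> 0"
  shows "smooth_on S (\<lambda>x. matrix_inv (A x) $ i $ j)"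
proof (rule smooth_on_cong)
  have "smooth_on S (\<lambda>x. if c = i then axis j 1 $ r else A x $ r $ c)" for r c
    by (cases "c = i") (auto intro: smooth_on_const[OF S] A)
  then have "smooth_on S (\<lambda>x. det (\<chi> r c. if c = i then axis j 1 $ r else A x $ r $ c))"
    by (intro smooth_on_det[OF S]) simp
  moreover have "smooth_on S (\<lambda>x. inverse (det (A x)))"
    using Ck_on_inverse[OF S _ nz] smooth_on_det[OF S A] by (simp add: smooth_on_def)
  ultimately show "smooth_on S (\<lambda>x. det (\<chi> r c. if c = i then axis j 1 $ r else A x $ r $ c) * inverse (det (A x)))"
    by (rule smooth_on_mult[OF S])
qed (simp add: matrix_inv_cramer nz)

lemma smooth_on_star_form:
  fixes G :: "'a::euclidean_space \<Rightarrow> ('n::{finite,linorder}) rmat"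
  assumes S: "axis_accessible S" and G: "\<And>i j. smooth_on S (\<lambda>x. G x $ i $ j)"
    and pos: "\<And>x. x \<in> S \<Longrightarrow> det (G x) > 0" and b: "\<And>v. smooth_on S (\<lambda>x. b x v)"
  shows "smooth_on S (\<lambda>x. star_form k (G x) (b x) v)"
proof -
  have sqrt: "smooth_on S (\<lambda>x. sqrt (det (G x)))"
    using Ck_on_sqrt[OF S _ pos] smooth_on_det[OF S G] by (simp add: smooth_on_def)
  have inv: "smooth_on S (\<lambda>x. matrix_inv (G x) $ i $ j)" for i j
    using pos by (intro smooth_on_matrix_inv[OF S G]) force
  have "smooth_on S (\<lambda>x. join k (raised (G x) J) v (index_rank i) $ j)" for J and i j :: 'n
    by (cases "index_rank i < k")
       (simp_all add: join_def matrix_vector_mult_basis column_def inv smooth_on_const[OF S])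
  then have "smooth_on S (\<lambda>x. det_form (join k (raised (G x) J) v))" for J
    unfolding det_form_def by (intro smooth_on_det[OF S]) simp
  then show ?thesis
    unfolding star_form_def divide_inverse
    by (intro smooth_on_sum[OF S] smooth_on_mult[OF S] sqrt smooth_on_const[OF S] b)
qed

section \<open>The Hodge star and the codifferential on a manifold\<close>

lemma chart_image_accessible:
  fixes c :: "('m, 'n::finite) chart"
  assumes "is_chart T c"
  shows "axis_accessible (snd c ` fst c)"
  using assms axis_accessible_half_space unfolding is_chart_def by blast

lemma forms_alternating: "\<omega> \<in> forms M k \<Longrightarrow> c \<in> atlas M \<Longrightarrow> p \<in> fst c \<Longrightarrow> alternating k (\<omega> c p)"
  unfolding forms_def by blast

lemma forms_smooth:
  "\<omega> \<in> forms M k \<Longrightarrow> c \<in> atlas M \<Longrightarrow> smooth_on (snd c ` fst c) (\<lambda>x. \<omega> c (chart_inv c x) v)"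
  unfolding forms_def by blast

lemma forms_outside: "\<omega> \<in> forms M k \<Longrightarrow> \<not> (c \<in> atlas M \<and> p \<in> fst c) \<Longrightarrow> \<omega> c p v = 0"
  unfolding forms_def by blast

lemma forms_transition:
  "\<omega> \<in> forms M k \<Longrightarrow> c \<in> atlas M \<Longrightarrow> c' \<in> atlas M \<Longrightarrow> p \<in> fst c \<Longrightarrow> p \<in> fst c' \<Longrightarrow>
    \<omega> c p v = \<omega> c' p (\<lambda>i. transition_jacobian c c' p *v v i)"
  unfolding forms_def by blast

lemma hodge_star_above_dimension:
  fixes M :: "('m, 'n::{finite,linorder}) riemannian"
  shows "CARD('n) < k \<Longrightarrow> hodge_star M k b = (\<lambda>c p v. 0)"
  by (auto simp: hodge_star_def fun_eq_iff)

lemma form_scale_sign: "form_scale ((- 1) ^ m) (form_scale r (form_scale ((- 1) ^ m) \<omega>)) = form_scale r \<omega>"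
  by (cases "even m") (auto simp: form_scale_def)

context
  fixes M :: "('m, 'n::{finite,linorder}) riemannian"
  assumes M: "oriented_riemannian_manifold M"
begin

lemma atlas_accessible: "c \<in> atlas M \<Longrightarrow> axis_accessible (snd c ` fst c)"
  using M chart_image_accessible unfolding oriented_riemannian_manifold_def by blast

lemma metric_symmetric: "c \<in> atlas M \<Longrightarrow> p \<in> fst c \<Longrightarrow> transpose (metric M c p) = metric M c p"
  using M unfolding oriented_riemannian_manifold_def by blast

lemma det_metric_pos: "c \<in> atlas M \<Longrightarrow> p \<in> fst c \<Longrightarrow> det (metric M c p) > 0"
  using M unfolding oriented_riemannian_manifold_def by (intro det_pos_definite) blast

lemma smooth_metric_entry:
  assumes "c \<in> atlas M"
  shows "smooth_on (snd c ` fst c) (\<lambda>x. metric M c (chart_inv c x) $ i $ j)"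
proof -
  have "smooth_on (snd c ` fst c) (\<lambda>x. metric M c (chart_inv c x))"
    using M assms unfolding oriented_riemannian_manifold_def by blast
  moreover have "bounded_linear (\<lambda>A :: 'n rmat. A $ i $ j)"
    by (intro bounded_linear_compose[OF bounded_linear_vec_nth bounded_linear_vec_nth])
  ultimately show ?thesis
    unfolding smooth_on_def using Ck_on_bounded_linear[OF atlas_accessible[OF assms]] by blast
qed

lemma hodge_star_forms:
  assumes b: "b \<in> forms M k" and kl: "k + l = CARD('n)"
  shows "hodge_star M k b \<in> forms M l"
  unfolding forms_def mem_Collect_eq
proof (intro conjI allI impI ballI)
  have k: "k \<le> CARD('n)"
    using kl by simp
  note star = hodge_star_eq_star_form[OF _ _ k]
  show "hodge_star M k b c p v = 0" if "\<not> (c \<in> atlas M \<and> p \<in> fst c)" for c p v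
    using that by (auto simp: hodge_star_def)
  show "alternating l (hodge_star M k b c p)" if "c \<in> atlas M" "p \<in> fst c" for c p
    using that by (simp add: star alternating_star_form[OF kl])
  show "smooth_on (snd c ` fst c) (\<lambda>x. hodge_star M k b c (chart_inv c x) v)" if c: "c \<in> atlas M" for c v
  proof (rule smooth_on_cong)
    show "smooth_on (snd c ` fst c)
        (\<lambda>x. star_form k (metric M c (chart_inv c x)) (b c (chart_inv c x)) v)"
      using c by (intro smooth_on_star_form atlas_accessible smooth_metric_entry det_metric_pos
          forms_smooth[OF b] inv_into_into)
  qed (simp add: star c inv_into_into)
  show "hodge_star M k b c p v = hodge_star M k b c' p (\<lambda>i. transition_jacobian c c' p *v v i)"
    if c: "c \<in> atlas M" and c': "c' \<in> atlas M" and p: "p \<in> fst c \<inter> fst c'" for c c' p v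
  proof -
    let ?T = "transition_jacobian c c' p"
    have T: "det ?T > 0" "metric M c p = transpose ?T ** metric M c' p ** ?T"
      using M c c' p unfolding oriented_riemannian_manifold_def by blast+
    have "b c p = (\<lambda>v. b c' p (\<lambda>i. ?T *v v i))"
      using c c' p by (intro ext forms_transition[OF b]) auto
    moreover have "multilinear k (b c' p)"
      using c' p by (intro alternating_multilinear forms_alternating[OF b]) auto
    ultimately show ?thesis
      using star_form_pullback[OF _ kl T(2) T(1), of "b c' p" v] det_metric_pos[OF c'] c c' p
      by (simp add: star)
  qed
qed

text \<open>The assumptions on b are pointwise, so that exterior derivatives are covered without
  showing that they lie in \<open>forms\<close>. Vanishing outside the charts makes the equation one
  of functions.\<close>

lemma hodge_star_hodge_star:
  assumes kl: "k + l = CARD('n)"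
    and alt: "\<And>c p. c \<in> atlas M \<Longrightarrow> p \<in> fst c \<Longrightarrow> alternating k (b c p)"
    and out: "\<And>c p v. \<not> (c \<in> atlas M \<and> p \<in> fst c) \<Longrightarrow> b c p v = 0"
  shows "hodge_star M l (hodge_star M k b) = form_scale ((- 1) ^ (k * l)) b"
proof (intro ext)
  fix c p v
  show "hodge_star M l (hodge_star M k b) c p v = form_scale ((- 1) ^ (k * l)) b c p v"
  proof (cases "c \<in> atlas M \<and> p \<in> fst c")
    case True
    then have "star_form l (metric M c p) (star_form k (metric M c p) (b c p)) = (\<lambda>v. (- 1) ^ (k * l) * b c p v)"
      by (intro star_form_star_form kl alt metric_symmetric det_metric_pos) auto
    then show ?thesis
      using True kl by (simp add: hodge_star_eq_star_form form_scale_def)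
  next
    case False
    then show ?thesis
      using out[OF False] by (auto simp: hodge_star_def form_scale_def)
  qed
qed

lemma hodge_star_scale: "hodge_star M k (form_scale r b) = form_scale r (hodge_star M k b)"
proof (intro ext)
  fix c p v
  show "hodge_star M k (form_scale r b) c p v = form_scale r (hodge_star M k b) c p v"
  proof (cases "c \<in> atlas M \<and> p \<in> fst c \<and> k \<le> CARD('n)")
    case True
    then show ?thesis
      by (simp add: hodge_star_eq_star_form form_scale_def star_form_def sum_distrib_left mult_ac)
  qed (auto simp: hodge_star_def form_scale_def)
qed

section \<open>The exterior derivative in charts\<close>

lemma forms_has_derivative:
  assumes "\<omega> \<in> forms M k" "c \<in> atlas M" "p \<in> fst c"
  shows "((\<lambda>x. \<omega> c (chart_inv c x) v) has_derivative
    frechet_derivative (\<lambda>x. \<omega> c (chart_inv c x) v) (at (snd c p) within snd c ` fst c))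
    (at (snd c p) within snd c ` fst c)"
  using assms by (intro differentiable_on_has_derivative smooth_on_differentiable forms_smooth) auto

lemma ext_deriv_scale:
  assumes \<omega>: "\<omega> \<in> forms M k"
  shows "ext_deriv M k (form_scale r \<omega>) = form_scale r (ext_deriv M k \<omega>)"
proof (intro ext)
  fix c p and v :: "nat \<Rightarrow> 'n rvec"
  show "ext_deriv M k (form_scale r \<omega>) c p v = form_scale r (ext_deriv M k \<omega>) c p v"
  proof (cases "c \<in> atlas M \<and> p \<in> fst c")
    case True
    have "frechet_derivative (\<lambda>x. r * \<omega> c (chart_inv c x) w) (at (snd c p) within snd c ` fst c) =
        (\<lambda>h. r * frechet_derivative (\<lambda>x. \<omega> c (chart_inv c x) w) (at (snd c p) within snd c ` fst c) h)" for w
      using True by (intro frechet_derivative_within_eq atlas_accessible has_derivative_mult_right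
          forms_has_derivative[OF \<omega>]) auto
    then show ?thesis
      using True by (simp add: ext_deriv_def form_scale_def sum_distrib_left mult.left_commute)
  qed (auto simp: ext_deriv_def form_scale_def)
qed

text \<open>For fixed direction h, differentiation in x commutes with linear combinations in y,
  because derivatives within the chart image are unique. This gives linearity of d\<omega> in the
  slots that do not serve as direction.\<close>

lemma linear_frechet_derivative:
  assumes \<omega>: "\<omega> \<in> forms M k" and c: "c \<in> atlas M" and p: "p \<in> fst c" and i: "i < k"
  shows "linear (\<lambda>y. frechet_derivative (\<lambda>x. \<omega> c (chart_inv c x) (w(i := y)))
    (at (snd c p) within snd c ` fst c) h)"
proof -
  let ?S = "snd c ` fst c"
  let ?D = "\<lambda>y. frechet_derivative (\<lambda>x. \<omega> c (chart_inv c x) (w(i := y))) (at (snd c p) within ?S)"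
  have x: "snd c p \<in> ?S"
    using p by simp
  have lin: "linear (\<lambda>y. \<omega> c (chart_inv c x) (w(i := y)))" if "x \<in> ?S" for x
    using forms_alternating[OF \<omega> c inv_into_into[OF that]] i
    by (intro multilinear_linear alternating_multilinear)
  have "?D (y + z) = (\<lambda>h. ?D y h + ?D z h)" for y z
  proof (rule trans[OF frechet_derivative_within_cong[OF _ x]])
    show "\<omega> c (chart_inv c u) (w(i := y + z)) = \<omega> c (chart_inv c u) (w(i := y)) + \<omega> c (chart_inv c u) (w(i := z))"
      if "u \<in> ?S" for u
      using linear_add[OF lin[OF that]] .
    show "frechet_derivative (\<lambda>u. \<omega> c (chart_inv c u) (w(i := y)) + \<omega> c (chart_inv c u) (w(i := z)))
        (at (snd c p) within ?S) = (\<lambda>h. ?D y h + ?D z h)"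
      by (intro frechet_derivative_within_eq atlas_accessible c x has_derivative_add forms_has_derivative[OF \<omega> c p])
  qed
  moreover have "?D (r *\<^sub>R y) = (\<lambda>h. r * ?D y h)" for r y
  proof (rule trans[OF frechet_derivative_within_cong[OF _ x]])
    show "\<omega> c (chart_inv c u) (w(i := r *\<^sub>R y)) = r * \<omega> c (chart_inv c u) (w(i := y))" if "u \<in> ?S" for u
      using linear_scale[OF lin[OF that]] by simp
    show "frechet_derivative (\<lambda>u. r * \<omega> c (chart_inv c u) (w(i := y))) (at (snd c p) within ?S) =
        (\<lambda>h. r * ?D y h)"
      by (intro frechet_derivative_within_eq atlas_accessible c x has_derivative_mult_right forms_has_derivative[OF \<omega> c p])
  qed
  ultimately show ?thesis
    by (intro linearI) simp_all
qed

text \<open>Let arguments i and i + 1 agree. A term omitting neither differentiates a function that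
  is identically zero, since \<omega> sees both; the two terms omitting one of them are equal up to
  opposite signs.\<close>

lemma alternating_ext_deriv:
  assumes \<omega>: "\<omega> \<in> forms M k" and c: "c \<in> atlas M" and p: "p \<in> fst c"
  shows "alternating (Suc k) (ext_deriv M k \<omega> c p)"
proof (rule adjacent_alternating)
  let ?S = "snd c ` fst c"
  let ?skip = "\<lambda>i v j. if j < i then v j else v (Suc j) :: 'n rvec"
  let ?D = "\<lambda>w. frechet_derivative (\<lambda>x. \<omega> c (chart_inv c x) w) (at (snd c p) within ?S)"
  have x: "snd c p \<in> ?S"
    using p by simp
  have alt: "alternating k (\<omega> c (chart_inv c x))" if "x \<in> ?S" for x
    using that c by (intro forms_alternating[OF \<omega>] inv_into_into)
  have eq: "ext_deriv M k \<omega> c p v = (\<Sum>i\<le>k. (- 1) ^ i * ?D (?skip i v) (v i))" for v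
    using c p by (simp add: ext_deriv_def)
  have D_cong: "?D w = ?D w'" if "\<And>j. j < k \<Longrightarrow> w j = w' j" for w w'
    using that by (intro frechet_derivative_within_cong[OF _ x] multilinear_cong[OF alternating_multilinear[OF alt]])
  show "multilinear (Suc k) (ext_deriv M k \<omega> c p)"
    unfolding multilinear_def
  proof (intro conjI allI impI)
    fix v v' :: "nat \<Rightarrow> 'n rvec" assume v: "\<forall>i<Suc k. v i = v' i"
    have "?D (?skip i v) = ?D (?skip i v')" if "i \<le> k" for i
      using v that by (intro D_cong) auto
    then show "ext_deriv M k \<omega> c p v = ext_deriv M k \<omega> c p v'"
      unfolding eq using v by (intro sum.cong refl) auto
  next
    fix v :: "nat \<Rightarrow> 'n rvec" and m assume m: "m < Suc k"
    have "linear (\<lambda>y. ?D (?skip i (v(m := y))) ((v(m := y)) i))" if i: "i \<le> k" for i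
    proof (cases "m = i")
      case True
      then have "?skip i (v(m := y)) = ?skip i v" for y
        by auto
      moreover have "linear (?D (?skip i v))"
        using has_derivative_linear[OF forms_has_derivative[OF \<omega> c p]] .
      ultimately show ?thesis
        using True by simp
    next
      case False
      \<comment> \<open>The slot of \<open>v m\<close> after \<open>v i\<close> has been
        removed.\<close>
      define m' where "m' = (if m < i then m else m - 1)"
      have "m' < k"
        using False m i by (auto simp: m'_def)
      moreover have "?skip i (v(m := y)) = (?skip i v)(m' := y)" for y
        using False by (auto simp: m'_def fun_eq_iff)
      ultimately show ?thesis
        using False linear_frechet_derivative[OF \<omega> c p, of m' "?skip i v" "v i"] by simp
    qed
    then have "linear (\<lambda>y. (- 1) ^ i * ?D (?skip i (v(m := y))) ((v(m := y)) i))" if "i \<le> k" for i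
      using linear_compose_scale_right that by fastforce
    then show "linear (\<lambda>y. ext_deriv M k \<omega> c p (v(m := y)))"
      unfolding eq by (intro linear_compose_sum) simp
  qed
  fix v :: "nat \<Rightarrow> 'n rvec" and i assume i: "Suc i < Suc k" and v: "v i = v (Suc i)"
  have zero: "?D (?skip j v) = (\<lambda>h. 0)" if j: "j \<le> k" "j \<noteq> i" "j \<noteq> Suc i" for j
  proof (rule trans[OF frechet_derivative_within_cong[OF _ x]])
    \<comment> \<open>After the removal of \<open>v j\<close>, the equal arguments occupy slots i'
      and i' + 1.\<close>
    define i' where "i' = (if i < j then i else i - 1)"
    have i': "Suc i' < k" "?skip j v i' = ?skip j v (Suc i')"
      using i v j by (auto simp: i'_def)
    show "\<omega> c (chart_inv c u) (?skip j v) = 0" if "u \<in> ?S" for u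
      by (rule alternating_eq_0[OF alt[OF that], of i' "Suc i'"]) (use i' in auto)
    show "frechet_derivative (\<lambda>u. 0) (at (snd c p) within ?S) = (\<lambda>h. 0)"
      by (intro frechet_derivative_within_eq atlas_accessible c x has_derivative_const)
  qed
  have "?skip i v = ?skip (Suc i) v"
    using v by (auto simp: fun_eq_iff less_Suc_eq)
  then have pair: "(- 1) ^ i * ?D (?skip i v) (v i) + (- 1) ^ Suc i * ?D (?skip (Suc i) v) (v (Suc i)) = 0"
    using v by simp
  have "ext_deriv M k \<omega> c p v = (\<Sum>j\<in>{i, Suc i}. (- 1) ^ j * ?D (?skip j v) (v j))"
    unfolding eq using i zero by (intro sum.mono_neutral_right) auto
  then show "ext_deriv M k \<omega> c p v = 0"
    using pair by simp
qed

lemma zero_form: "(\<lambda>c p v. 0) \<in> forms M k"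
  unfolding forms_def using smooth_on_const[OF atlas_accessible] by (auto simp: alternating_zero)

lemma hodge_star_zero: "hodge_star M k (\<lambda>c p v. 0) = (\<lambda>c p v. 0)"
  using hodge_star_scale[of k 0 "\<lambda>c p v. 0"] by (simp add: form_scale_def)

lemma ext_deriv_zero: "ext_deriv M k (\<lambda>c p v. 0) = (\<lambda>c p v. 0)"
  using ext_deriv_scale[OF zero_form, of k 0] by (simp add: form_scale_def)

text \<open>P stands for the projection of either complex. \<open>P_scale\<close> is demanded for
  all families \<omega> because it is applied to multiples of dA; with r = 0 it also shows that P
  preserves zero.\<close>

lemma coprojection_codifferential:
  fixes P :: "nat \<Rightarrow> ('m, 'n) form \<Rightarrow> ('m, 'n) form"
  assumes P_forms: "\<And>l \<omega>. P l \<omega> \<in> forms M l"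
    and P_scale: "\<And>l r \<omega>. P l (form_scale r \<omega>) = form_scale r (P l \<omega>)"
    and P_deriv: "\<And>l \<omega>. \<omega> \<in> forms M l \<Longrightarrow> P (Suc l) (ext_deriv M l \<omega>) = ext_deriv M l (P l \<omega>)"
    and a: "a \<in> forms M k"
  shows "coprojection M P (k - 1) (codifferential M k a) = codifferential M k (coprojection M P k a)"
proof (cases "1 \<le> k \<and> k \<le> CARD('n)")
  case True
  define l where "l = CARD('n) - k"
  \<comment> \<open>The degree complementary to k - 1 is \<open>Suc l\<close>. With truncated
    subtraction this requires 1 \<le> k \<le> n.\<close>
  have kl: "k + l = CARD('n)" "l + k = CARD('n)" and kl': "Suc l + (k - 1) = CARD('n)"
    and Suc_l: "CARD('n) - k + 1 = Suc l" "CARD('n) - (k - 1) = Suc l"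
    using True by (auto simp: l_def)
  define A where "A = hodge_star M k a"
  have A: "A \<in> forms M l"
    unfolding A_def by (rule hodge_star_forms[OF a kl(1)])
  define \<sigma> :: real where "\<sigma> = (- 1) ^ (CARD('n) * (k + 1) + 1)"
  have codiff: "codifferential M k b = form_scale \<sigma> (hodge_star M (Suc l) (ext_deriv M l (hodge_star M k b)))" for b
    by (simp add: codifferential_def \<sigma>_def Suc_l flip: l_def)
  have "hodge_star M (k - 1) (hodge_star M (Suc l) (ext_deriv M l A)) =
      form_scale ((- 1) ^ (Suc l * (k - 1))) (ext_deriv M l A)"
    by (rule hodge_star_hodge_star[OF kl' alternating_ext_deriv[OF A]]) (auto simp: ext_deriv_def)
  then have "coprojection M P (k - 1) (codifferential M k a) =
      form_scale ((- 1) ^ ((k - 1) * Suc l)) (form_scale \<sigma> (form_scale ((- 1) ^ (Suc l * (k - 1)))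
        (hodge_star M (Suc l) (ext_deriv M l (P l A)))))"
    by (simp only: coprojection_def codiff Suc_l hodge_star_scale P_scale P_deriv[OF A] flip: A_def)
  \<comment> \<open>The sign in the coprojection cancels that of \<star>\<star> on dA.\<close>
  also have "\<dots> = form_scale \<sigma> (hodge_star M (Suc l) (ext_deriv M l (P l A)))"
    by (simp only: mult.commute[of "k - 1"] form_scale_sign)
  finally have left: "coprojection M P (k - 1) (codifferential M k a) = \<dots>" .
  have "hodge_star M k (hodge_star M l (P l A)) = form_scale ((- 1) ^ (l * k)) (P l A)"
    by (rule hodge_star_hodge_star[OF kl(2)])
       (auto intro: forms_alternating[OF P_forms] forms_outside[OF P_forms])
  then have "hodge_star M k (coprojection M P k a) =
      form_scale ((- 1) ^ (k * l)) (form_scale ((- 1) ^ (l * k)) (P l A))"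
    by (simp only: coprojection_def hodge_star_scale flip: A_def l_def)
  also have "\<dots> = P l A"
    by (simp add: form_scale_def mult.commute[of k] power_mult_distrib[symmetric] mult.assoc[symmetric])
  finally have "codifferential M k (coprojection M P k a) =
      form_scale \<sigma> (hodge_star M (Suc l) (ext_deriv M l (P l A)))"
    by (simp only: codiff)
  with left show ?thesis
    by simp
next
  case False
  \<comment> \<open>Here k = 0 or k > n. Either way the codifferential is zero on every argument,
    and coprojections preserve zero.\<close>
  have P_zero: "P l (\<lambda>c p v. 0) = (\<lambda>c p v. 0)" for l
    using P_scale[of l 0 "\<lambda>c p v. 0"] by (simp add: form_scale_def)
  have "codifferential M k b = (\<lambda>c p v. 0)" for b
  proof (cases "k = 0")
    case True
    then show ?thesis
      by (simp add: codifferential_def hodge_star_above_dimension form_scale_def)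
  next
    case nz: False
    with False have "hodge_star M k b = (\<lambda>c p v. 0)"
      by (intro hodge_star_above_dimension) simp
    then show ?thesis
      by (simp add: codifferential_def ext_deriv_zero hodge_star_zero form_scale_def)
  qed
  then show ?thesis
    by (simp add: coprojection_def hodge_star_zero P_zero form_scale_def)
qed

end

section \<open>Reduction to cochains and the concrete projections\<close>

lemma chains_add: "x \<in> chains D S k \<Longrightarrow> y \<in> chains D S k \<Longrightarrow> (\<lambda>\<sigma>. x \<sigma> + y \<sigma>) \<in> chains D S k"
  by (simp add: chains_def) (metis add.right_neutral)

lemma chains_scale: "x \<in> chains D S k \<Longrightarrow> (\<lambda>\<sigma>. r * x \<sigma>) \<in> chains D S k"
  unfolding chains_def by auto

text \<open>Linearity is meant in the chain, whatever the integrals of \<omega> are; hence the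
  reconstruction of a reduction is always a form.\<close>

lemma reduction_cochain: "reduction M D S k \<omega> \<in> cochains D S k"
  unfolding cochains_def reduction_def
  by (simp add: chains_add chains_scale distrib_right sum.distrib sum_distrib_left mult.assoc)

text \<open>A scalar can be pulled out of the integral even if the integrand is not integrable, so
  \<omega> may be arbitrary, in particular dA.\<close>

lemma reduction_scale: "reduction M D S k (form_scale r \<omega>) = (\<lambda>x. r * reduction M D S k \<omega> x)"
proof -
  have "cell_integral M k \<tau> (form_scale r \<omega>) = r * cell_integral M k \<tau> \<omega>" for \<tau>
    by (simp add: cell_integral_def form_scale_def)
  then show ?thesis
    by (simp add: reduction_def fun_eq_iff sum_distrib_left mult.left_commute)
qed

text \<open>Commutation of the projection with d is the chain I R d = I \<delta> R = d I R, where
  Stokes' theorem gives the first step and the reconstruction property, applied to the cochain R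
  \<omega>, the second.\<close>

lemma projection_coprojection_codifferential:
  fixes M :: "('m, 'n::{finite,linorder}) riemannian"
  assumes M: "oriented_riemannian_manifold M" and I: "reconstruction M D S I"
    and stokes: "\<And>l \<omega>. \<omega> \<in> forms M l \<Longrightarrow>
      reduction M D S (Suc l) (ext_deriv M l \<omega>) = coboundary D S l (reduction M D S l \<omega>)"
    and a: "a \<in> forms M k"
  shows "coprojection M (projection M D S I) (k - 1) (codifferential M k a) =
    codifferential M k (coprojection M (projection M D S I) k a)"
  using M _ _ _ a
proof (rule coprojection_codifferential)
  fix l \<omega>
  show "projection M D S I l \<omega> \<in> forms M l"
    using I reduction_cochain unfolding reconstruction_def projection_def by blast
  show "projection M D S I l (form_scale r \<omega>) = form_scale r (projection M D S I l \<omega>)" for r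
    using I reduction_cochain unfolding reconstruction_def projection_def reduction_scale by blast
  show "projection M D S I (Suc l) (ext_deriv M l \<omega>) = ext_deriv M l (projection M D S I l \<omega>)"
    if "\<omega> \<in> forms M l"
    using I reduction_cochain unfolding reconstruction_def projection_def stokes[OF that] by metis
qed

text \<open>Each coprojection is formed with the projection of the opposite complex, so the first
  conjunct rests on the data of \<open>D'\<close> and the second on those of
  \<open>D\<close>.\<close>

theorem proposition27:
  fixes M :: "('m, 'n::{finite,linorder}) riemannian"
    and D :: "('c, 'm) cell_complex" and D' :: "('d, 'm) cell_complex"
    and dual :: "'c \<Rightarrow> 'd" and Di :: "'c set" and Di' :: "'d set"
    and I :: "nat \<Rightarrow> (('c \<Rightarrow> real) \<Rightarrow> real) \<Rightarrow> ('m, 'n) form"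
    and I' :: "nat \<Rightarrow> (('d \<Rightarrow> real) \<Rightarrow> real) \<Rightarrow> ('m, 'n) form"
    and a :: "('m, 'n) form" and k :: nat
  assumes "oriented_riemannian_manifold M"
    and "oriented_cell_complex M D" and "oriented_cell_complex M D'"
    and "dual_complex M D D' dual"
    and "Di \<subseteq> cells D" and "Di' = dual ` Di"
    and "\<And>l \<omega>. \<omega> \<in> forms M l \<Longrightarrow>
           reduction M D Di (Suc l) (ext_deriv M l \<omega>) = coboundary D Di l (reduction M D Di l \<omega>)"
    and "\<And>l \<omega>. \<omega> \<in> forms M l \<Longrightarrow>
           reduction M D' Di' (Suc l) (ext_deriv M l \<omega>) = coboundary D' Di' l (reduction M D' Di' l \<omega>)"
    and "reconstruction M D Di I" and "reconstruction M D' Di' I'"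
    and "a \<in> forms M k"
  shows "coprojection M (projection M D' Di' I') (k - 1) (codifferential M k a) =
           codifferential M k (coprojection M (projection M D' Di' I') k a) \<and>
         coprojection M (projection M D Di I) (k - 1) (codifferential M k a) =
           codifferential M k (coprojection M (projection M D Di I) k a)"
  using projection_coprojection_codifferential[OF assms(1,10,8,11)]
    projection_coprojection_codifferential[OF assms(1,9,7,11)] by (rule conjI)

end
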